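(* Let $(M,\varphi)$ be a manifold with $G_2$-structure such that $d\varphi=0$. If $M$ is closed (i.e., compact and $\partial M=\emptyset$), then there is no contact structure on $M$ which is A-compatible with $\varphi$.
   Context: A $G_2$-structure on a smooth $7$-manifold $M$ is a $3$-form $\varphi$ on $M$ such that for every $p\in M$ the pair $(T_pM,\varphi_p)$ is linearly isomorphic to $(\mathbb{R}^7,\varphi_0)$, where $\varphi_0=e^{123}+e^{145}+e^{167}+e^{246}-e^{257}-e^{347}-e^{356}$ and $e^{ijk}=dx_i\wedge dx_j\wedge dx_k$. Such a $\varphi$ determines a Riemannian metric $g_\varphi$ and a volume form $\mathrm{Vol}$ on $M$ with $(\iota_u\varphi)\wedge(\iota_v\varphi)\wedge\varphi=6\,g_\varphi(u,v)\,\mathrm{Vol}$ for all vector fields $u,v$, where $\iota$ denotes interior product. A contact form on a $(2n+1)$-dimensional manifold is a $1$-form $\alpha$ with $\alpha\wedge(d\alpha)^n$ nowhere zero. A co-oriented contact structure is a hyperplane distribution $\xi=\mathrm{Ker}(\alpha)$ for a global contact form $\alpha$; any such $\alpha$ is called a contact form for $\xi$. The Reeb vector field of a contact form $\alpha$ is the unique vector field $R$ with $\iota_R d\alpha=0$ and $\alpha(R)=1$. A co-oriented contact structure $\xi$ on $(M,\varphi)$ is A-compatible with $\varphi$ if there exist a vector field $R$ on $M$ and a nowhere-zero function $f:M\to\mathbb{R}$ such that $d\alpha=\iota_R\varphi$ for some contact form $\alpha$ for $\xi$, and $fR$ is the Reeb vector field of some (possibly different) contact form for $\xi$. *)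

theory Defs
  imports "HOL-Analysis.Analysis" "HOL-Combinatorics.Combinatorics"
begin

section \<open>Smooth maps between Euclidean spaces\<close>

fun Ck_on :: "nat \<Rightarrow> 'e::euclidean_space set \<Rightarrow> ('e \<Rightarrow> 'f::real_normed_vector) \<Rightarrow> bool" where
  "Ck_on 0 W f \<longleftrightarrow> continuous_on W f"
| "Ck_on (Suc k) W f \<longleftrightarrow>
     (\<forall>x\<in>W. f differentiable (at x)) \<and>
     (\<forall>v. Ck_on k W (\<lambda>x. frechet_derivative f (at x) v))"

text \<open>Only used for open sets \<^term>\<open>W\<close>.\<close>

definition smooth_on :: "'e::euclidean_space set \<Rightarrow> ('e \<Rightarrow> 'f::real_normed_vector) \<Rightarrow> bool" where
  "smooth_on W f \<longleftrightarrow> (\<forall>k. Ck_on k W f)"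


section \<open>Alternating forms on a vector space\<close>

text \<open>A \<open>k\<close>-form on a vector space is a function of a sequence of vectors that only looks at
  the entries \<open>0, \<dots>, k - 1\<close>. The degree is not part of the type, so
  it is passed explicitly to the operations that depend on it.\<close>

type_synonym 'e form = "(nat \<Rightarrow> 'e) \<Rightarrow> real"

definition alternating_form :: "nat \<Rightarrow> 'e::real_vector form \<Rightarrow> bool" where
  "alternating_form k \<omega> \<longleftrightarrow>
     (\<forall>v w. (\<forall>i<k. v i = w i) \<longrightarrow> \<omega> v = \<omega> w) \<and>
     (\<forall>v. \<forall>i<k. linear (\<lambda>u. \<omega> (v(i := u)))) \<and>
     (\<forall>v i j. i < j \<and> j < k \<and> v i = v j \<longrightarrow> \<omega> v = 0)"

text \<open>Normalised so that \<open>(dx\<^sub>1 \<and> \<dots> \<and> dx\<^sub>k)(e\<^sub>1, \<dots>, e\<^sub>k) = 1\<close>.\<close>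

definition wedge :: "nat \<Rightarrow> nat \<Rightarrow> 'e form \<Rightarrow> 'e form \<Rightarrow> 'e form" where
  "wedge k l \<omega> \<eta> = (\<lambda>v.
     (\<Sum>\<sigma> | \<sigma> permutes {..<k + l}.
        of_int (sign \<sigma>) * \<omega> (\<lambda>i. v (\<sigma> i)) * \<eta> (\<lambda>i. v (\<sigma> (k + i)))) / (fact k * fact l))"

primrec wedge_power :: "nat \<Rightarrow> 'e form \<Rightarrow> nat \<Rightarrow> 'e form" where
  "wedge_power k \<omega> 0 = (\<lambda>v. 1)"
| "wedge_power k \<omega> (Suc n) = wedge k (k * n) \<omega> (wedge_power k \<omega> n)"

definition interior_product :: "'e \<Rightarrow> 'e form \<Rightarrow> 'e form" where
  "interior_product u \<omega> = (\<lambda>v. \<omega> (case_nat u v))"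

definition pullback_form :: "('e \<Rightarrow> 'f) \<Rightarrow> 'f form \<Rightarrow> 'e form" where
  "pullback_form L \<omega> = (\<lambda>v. \<omega> (\<lambda>i. L (v i)))"

text \<open>The exterior derivative of a \<open>k\<close>-form on (an open subset of) a Euclidean space:
  \<open>d\<omega>(v\<^sub>0, \<dots>, v\<^sub>k) = \<Sum>\<^sub>i (-1)\<^sup>i D\<omega>[v\<^sub>i](v\<^sub>0, \<dots>, v\<^sub>k)\<close> with \<open>v\<^sub>i\<close> omitted from the arguments of the
  \<open>i\<close>-th summand.\<close>

definition ext_deriv :: "nat \<Rightarrow> ('e::euclidean_space \<Rightarrow> 'e form) \<Rightarrow> 'e \<Rightarrow> 'e form" where
  "ext_deriv k \<omega> x = (\<lambda>v. \<Sum>i\<le>k. (- 1) ^ i *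
     frechet_derivative (\<lambda>y. \<omega> y (\<lambda>j. v (if j < i then j else Suc j))) (at x) (v i))"


section \<open>Smooth manifolds\<close>

type_synonym ('a, 'e) chart = "'a set \<times> ('a \<Rightarrow> 'e)"

definition chart_image :: "('a, 'e) chart \<Rightarrow> 'e set" where
  "chart_image c = snd c ` fst c"

definition chart_inv :: "('a, 'e) chart \<Rightarrow> 'e \<Rightarrow> 'a" where
  "chart_inv c = inv_into (fst c) (snd c)"

definition overlap :: "('a, 'e) chart \<Rightarrow> ('a, 'e) chart \<Rightarrow> 'e set" where
  "overlap c c' = snd c ` (fst c \<inter> fst c')"

definition transition :: "('a, 'e) chart \<Rightarrow> ('a, 'e) chart \<Rightarrow> 'e \<Rightarrow> 'e" where
  "transition c c' = snd c' \<circ> chart_inv c"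

definition is_chart :: "'a topology \<Rightarrow> ('a, 'e::euclidean_space) chart \<Rightarrow> bool" where
  "is_chart X c \<longleftrightarrow>
     openin X (fst c) \<and> open (chart_image c) \<and>
     homeomorphic_map (subtopology X (fst c)) (top_of_set (chart_image c)) (snd c)"

definition second_countable_space :: "'a topology \<Rightarrow> bool" where
  "second_countable_space X \<longleftrightarrow>
     (\<exists>\<B>. countable \<B> \<and> (\<forall>V\<in>\<B>. openin X V) \<and>
        (\<forall>U x. openin X U \<and> x \<in> U \<longrightarrow> (\<exists>V\<in>\<B>. x \<in> V \<and> V \<subseteq> U)))"

text \<open>The atlas need not be maximal. Charts take values in open subsets of the model space, so
  these are manifolds without boundary; a closed manifold is one with \<^term>\<open>compact_space X\<close>.\<close>

definition smooth_manifold :: "'a topology \<Rightarrow> ('a, 'e::euclidean_space) chart set \<Rightarrow> bool" where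
  "smooth_manifold X A \<longleftrightarrow>
     Hausdorff_space X \<and> second_countable_space X \<and>
     (\<forall>c\<in>A. is_chart X c) \<and> (\<Union>c\<in>A. fst c) = topspace X \<and>
     (\<forall>c\<in>A. \<forall>c'\<in>A. smooth_on (overlap c c') (transition c c'))"


section \<open>Vector fields and differential forms on manifolds\<close>

text \<open>A chart \<open>c\<close> around \<open>p\<close> identifies the tangent space at \<open>p\<close> with the model space. Vector
  fields, differential forms and distributions are given by their expressions in the charts of
  the atlas: \<open>\<omega> c x\<close> is the value at the point with coordinates \<open>x\<close> in the chart \<open>c\<close>. The
  expressions in two charts have to correspond under the derivative of the transition map.
  Values outside the chart images are irrelevant.\<close>

type_synonym ('a, 'e) vfield = "('a, 'e) chart \<Rightarrow> 'e \<Rightarrow> 'e"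
type_synonym ('a, 'e) dform = "('a, 'e) chart \<Rightarrow> 'e \<Rightarrow> 'e form"
type_synonym ('a, 'e) distribution = "('a, 'e) chart \<Rightarrow> 'e \<Rightarrow> 'e set"

definition vector_field ::
    "('a, 'e::euclidean_space) chart set \<Rightarrow> ('a, 'e) vfield \<Rightarrow> bool" where
  "vector_field A R \<longleftrightarrow>
     (\<forall>c\<in>A. smooth_on (chart_image c) (R c)) \<and>
     (\<forall>c\<in>A. \<forall>c'\<in>A. \<forall>x\<in>overlap c c'.
        R c' (transition c c' x) = frechet_derivative (transition c c') (at x) (R c x))"

definition diff_form ::
    "('a, 'e::euclidean_space) chart set \<Rightarrow> nat \<Rightarrow> ('a, 'e) dform \<Rightarrow> bool" where
  "diff_form A k \<omega> \<longleftrightarrow>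
     (\<forall>c\<in>A. (\<forall>x\<in>chart_image c. alternating_form k (\<omega> c x)) \<and>
             (\<forall>v. smooth_on (chart_image c) (\<lambda>x. \<omega> c x v))) \<and>
     (\<forall>c\<in>A. \<forall>c'\<in>A. \<forall>x\<in>overlap c c'.
        \<omega> c x = pullback_form (frechet_derivative (transition c c') (at x))
                              (\<omega> c' (transition c c' x)))"

definition form_eq ::
    "('a, 'e) chart set \<Rightarrow> ('a, 'e) dform \<Rightarrow> ('a, 'e) dform \<Rightarrow> bool" where
  "form_eq A \<omega> \<eta> \<longleftrightarrow> (\<forall>c\<in>A. \<forall>x\<in>chart_image c. \<omega> c x = \<eta> c x)"

definition zero_dform :: "('a, 'e) dform" where
  "zero_dform = (\<lambda>c x v. 0)"

definition ext_deriv_dform :: "nat \<Rightarrow> ('a, 'e::euclidean_space) dform \<Rightarrow> ('a, 'e) dform" where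
  "ext_deriv_dform k \<omega> = (\<lambda>c. ext_deriv k (\<omega> c))"

definition interior_dform :: "('a, 'e) vfield \<Rightarrow> ('a, 'e) dform \<Rightarrow> ('a, 'e) dform" where
  "interior_dform R \<omega> = (\<lambda>c x. interior_product (R c x) (\<omega> c x))"

definition scale_vfield ::
    "('a \<Rightarrow> real) \<Rightarrow> ('a, 'e::real_vector) vfield \<Rightarrow> ('a, 'e) vfield" where
  "scale_vfield f R = (\<lambda>c x. f (chart_inv c x) *\<^sub>R R c x)"


section \<open>Contact structures\<close>

definition contact_form ::
    "('a, 'e::euclidean_space) chart set \<Rightarrow> ('a, 'e) dform \<Rightarrow> bool" where
  "contact_form A \<alpha> \<longleftrightarrow>
     diff_form A 1 \<alpha> \<and>
     (\<exists>n. DIM('e) = 2 * n + 1 \<and>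
        (\<forall>c\<in>A. \<forall>x\<in>chart_image c.
           wedge 1 (2 * n) (\<alpha> c x) (wedge_power 2 (ext_deriv_dform 1 \<alpha> c x) n) \<noteq> (\<lambda>v. 0)))"

definition contact_form_for ::
    "('a, 'e::euclidean_space) chart set \<Rightarrow> ('a, 'e) distribution \<Rightarrow> ('a, 'e) dform \<Rightarrow> bool" where
  "contact_form_for A \<xi> \<alpha> \<longleftrightarrow>
     contact_form A \<alpha> \<and>
     (\<forall>c\<in>A. \<forall>x\<in>chart_image c. \<xi> c x = {u. \<alpha> c x (\<lambda>_. u) = 0})"

definition contact_structure ::
    "('a, 'e::euclidean_space) chart set \<Rightarrow> ('a, 'e) distribution \<Rightarrow> bool" where
  "contact_structure A \<xi> \<longleftrightarrow> (\<exists>\<alpha>. contact_form_for A \<xi> \<alpha>)"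

definition reeb_vector_field ::
    "('a, 'e::euclidean_space) chart set \<Rightarrow> ('a, 'e) dform \<Rightarrow> ('a, 'e) vfield \<Rightarrow> bool" where
  "reeb_vector_field A \<alpha> R \<longleftrightarrow>
     vector_field A R \<and>
     form_eq A (interior_dform R (ext_deriv_dform 1 \<alpha>)) zero_dform \<and>
     (\<forall>c\<in>A. \<forall>x\<in>chart_image c. \<alpha> c x (\<lambda>_. R c x) = 1)"


section \<open>\<open>G\<^sub>2\<close>-structures\<close>

text \<open>The indices are elements of the seven-element type \<^typ>\<open>7\<close>, in which \<open>7 = 0\<close>; the numerals
  \<open>1, \<dots>, 7\<close> denote its seven distinct elements.\<close>

definition dx :: "7 \<Rightarrow> (real ^ 7) form" where
  "dx i = (\<lambda>v. v 0 $ i)"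

definition e3 :: "7 \<Rightarrow> 7 \<Rightarrow> 7 \<Rightarrow> (real ^ 7) form" where
  "e3 i j k = wedge 1 2 (dx i) (wedge 1 1 (dx j) (dx k))"

definition phi0 :: "(real ^ 7) form" where
  "phi0 = (\<lambda>v. e3 1 2 3 v + e3 1 4 5 v + e3 1 6 7 v + e3 2 4 6 v
             - e3 2 5 7 v - e3 3 4 7 v - e3 3 5 6 v)"

definition G2_structure ::
    "('a, real ^ 7) chart set \<Rightarrow> ('a, real ^ 7) dform \<Rightarrow> bool" where
  "G2_structure A \<phi> \<longleftrightarrow>
     diff_form A 3 \<phi> \<and>
     (\<forall>c\<in>A. \<forall>x\<in>chart_image c.
        \<exists>L. linear L \<and> bij L \<and> pullback_form L (\<phi> c x) = phi0)"

text \<open>No smoothness is required of \<open>f\<close>, only that \<open>f R\<close> is a (smooth) Reeb vector field.\<close>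

definition A_compatible ::
    "'a topology \<Rightarrow> ('a, real ^ 7) chart set \<Rightarrow> ('a, real ^ 7) dform \<Rightarrow>
     ('a, real ^ 7) distribution \<Rightarrow> bool" where
  "A_compatible X A \<phi> \<xi> \<longleftrightarrow>
     contact_structure A \<xi> \<and>
     (\<exists>R f. vector_field A R \<and> (\<forall>p\<in>topspace X. f p \<noteq> 0) \<and>
        (\<exists>\<alpha>. contact_form_for A \<xi> \<alpha> \<and>
             form_eq A (ext_deriv_dform 1 \<alpha>) (interior_dform R \<phi>)) \<and>
        (\<exists>\<beta>. contact_form_for A \<xi> \<beta> \<and> reeb_vector_field A \<beta> (scale_vfield f R)))"

end

theory Submission
  imports Defs
begin

text \<open>The six-form \<open>\<alpha> \<and> d\<alpha> \<and> \<phi>\<close> is a primitive of \<open>d\<alpha> \<and> d\<alpha> \<and> \<phi> = (\<iota>\<^sub>R \<phi>) \<and> (\<iota>\<^sub>R \<phi>) \<and> \<phi>\<close>, because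
  \<open>d\<phi> = 0\<close>. The latter form is \<open>6 |R|\<^sup>2 Vol\<close> and vanishes nowhere, since a multiple of \<open>R\<close> is a Reeb
  field. By Stokes' theorem a closed manifold has no exact volume form.

  Forms of degree 6 and 7 are handled as vector densities and densities, so that the exterior
  derivative becomes the divergence; the integral over the manifold is a sum of integrals in
  charts, weighted by a partition of unity that is only continuously differentiable.\<close>

section \<open>Continuously differentiable maps\<close>

text \<open>The obstacle is orientation: transition maps may reverse it, so signed integrals in
  different charts cannot simply be compared. Under a transition the vector density \<open>Y\<close>
  and its divergence \<open>T\<close> both pick up the determinant. As \<open>T\<close> has no zero,
  \<open>Y / T\<close> is a vector field, while |T| changes by the absolute value of the
  determinant, exactly as the change of variables formula asks, and so defines a measure. The sign
  of \<open>T\<close> is locally constant, hence \<open>Y / T\<close> has divergence 1 with respect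
  to this measure. The contradiction is that the total mass, which is positive, is the integral of a
  divergence. Products of forms are not computed with \<open>wedge\<close> but as signed sums over
  permutations of the standard basis (\<open>alternation\<close>), without dividing by factorials.
  For two 2-forms and a 3-form this multiplies the wedge product by 2! 2! 3! = 24, so that 6 |R|^2
  shows up as 144 |R|^2. For \<alpha>, d\<alpha>, \<phi> and one free slot the factor is 2! 3! = 12,
  which explains the 1/2 between \<open>T\<close> and the full alternation.\<close>

abbreviation C1_on :: "'e::euclidean_space set \<Rightarrow> ('e \<Rightarrow> 'f::real_normed_vector) \<Rightarrow> bool" where
  "C1_on \<equiv> Ck_on (Suc 0)"

declare Ck_on.simps [simp del]

lemma C1_on_has_derivative:
  "C1_on U f \<Longrightarrow> x \<in> U \<Longrightarrow> (f has_derivative frechet_derivative f (at x)) (at x)"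
  by (simp add: Ck_on.simps frechet_derivative_works[symmetric])

lemma C1_on_continuous_derivative:
  "C1_on U f \<Longrightarrow> continuous_on U (\<lambda>x. frechet_derivative f (at x) v)"
  by (simp add: Ck_on.simps)

lemma C1_on_linear: "C1_on U f \<Longrightarrow> x \<in> U \<Longrightarrow> linear (frechet_derivative f (at x))"
  by (simp add: Ck_on.simps linear_frechet_derivative)

lemma C1_on_continuous: "C1_on U f \<Longrightarrow> continuous_on U f"
  by (auto simp: Ck_on.simps continuous_on_eq_continuous_within
      continuous_at_imp_continuous_at_within differentiable_imp_continuous_within)

lemma C1_onI:
  assumes "\<And>x. x \<in> U \<Longrightarrow> (f has_derivative f' x) (at x)"
    and "\<And>v. continuous_on U (\<lambda>x. f' x v)"
  shows "C1_on U f"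
proof -
  have "frechet_derivative f (at x) = f' x" if "x \<in> U" for x
    using frechet_derivative_at[OF assms(1)[OF that]] by simp
  then have "continuous_on U (\<lambda>x. frechet_derivative f (at x) v)" for v
    using assms(2)[of v] by (auto cong: continuous_on_cong)
  then show ?thesis
    using assms(1) by (auto simp: Ck_on.simps differentiable_def)
qed

lemma Ck_on_subset: "Ck_on k U f \<Longrightarrow> V \<subseteq> U \<Longrightarrow> Ck_on k V f"
  by (induction k arbitrary: f) (auto simp: Ck_on.simps intro: continuous_on_subset)

lemma C1_on_cong:
  assumes "open U" "C1_on U f" "\<And>x. x \<in> U \<Longrightarrow> f x = g x"
  shows "C1_on U g"
proof (rule C1_onI)
  show "(g has_derivative frechet_derivative f (at x)) (at x)" if "x \<in> U" for x
    using has_derivative_transform_within_open[OF C1_on_has_derivative[OF assms(2) that] assms(1) that]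
      assms(3) by auto
  show "continuous_on U (\<lambda>x. frechet_derivative f (at x) v)" for v
    using assms(2) by (rule C1_on_continuous_derivative)
qed

text \<open>Differentiability at a point and continuity on open sets are local. This is the device
  for extension by zero: one open set carries the function, the other is the complement of its
  support.\<close>

lemma C1_on_Un:
  assumes "open U" "open V" "C1_on U f" "C1_on V f"
  shows "C1_on (U \<union> V) f"
  using assms by (auto simp: Ck_on.simps intro: continuous_on_open_Un)

lemma C1_on_const: "C1_on U (\<lambda>x. c)"
  by (rule C1_onI[of _ _ "\<lambda>x v. 0"]) auto

lemma C1_on_add:
  assumes "C1_on U f" "C1_on U g"
  shows "C1_on U (\<lambda>x. f x + g x)"
proof (rule C1_onI)
  show "((\<lambda>x. f x + g x) has_derivative
      (\<lambda>v. frechet_derivative f (at x) v + frechet_derivative g (at x) v)) (at x)" if "x \<in> U" for x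
    using C1_on_has_derivative assms that by (intro has_derivative_add) auto
qed (use assms in \<open>auto intro!: continuous_intros C1_on_continuous_derivative\<close>)

lemma C1_on_sum:
  "finite I \<Longrightarrow> (\<And>i. i \<in> I \<Longrightarrow> C1_on U (f i)) \<Longrightarrow> C1_on U (\<lambda>x. \<Sum>i\<in>I. f i x)"
  by (induction I rule: finite_induct) (simp_all add: C1_on_const C1_on_add)

lemma C1_on_bilinear:
  assumes "bounded_bilinear h" "C1_on U f" "C1_on U g"
  shows "C1_on U (\<lambda>x. h (f x) (g x))"
proof (rule C1_onI)
  show "((\<lambda>x. h (f x) (g x)) has_derivative
      (\<lambda>v. h (f x) (frechet_derivative g (at x) v) + h (frechet_derivative f (at x) v) (g x))) (at x)"
    if "x \<in> U" for x
    using that by (intro bounded_bilinear.FDERIV[OF assms(1)] C1_on_has_derivative[OF assms(2)]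
        C1_on_has_derivative[OF assms(3)])
  show "continuous_on U (\<lambda>x. h (f x) (frechet_derivative g (at x) v) +
      h (frechet_derivative f (at x) v) (g x))" for v
    using assms(2,3) by (intro continuous_on_add bounded_bilinear.continuous_on[OF assms(1)]
        C1_on_continuous_derivative) (auto intro: C1_on_continuous)
qed

lemmas C1_on_mult = C1_on_bilinear[OF bounded_bilinear_mult[where 'a=real]]
lemmas C1_on_scaleR = C1_on_bilinear[OF bounded_bilinear_scaleR]

lemma C1_on_divide:
  fixes f g :: "'e::euclidean_space \<Rightarrow> real"
  assumes "C1_on U f" "C1_on U g" "\<And>x. x \<in> U \<Longrightarrow> g x \<noteq> 0"
  shows "C1_on U (\<lambda>x. f x / g x)"
proof -
  have "C1_on U (\<lambda>x. inverse (g x))"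
  proof (rule C1_onI)
    show "((\<lambda>x. inverse (g x)) has_derivative
        (\<lambda>v. - (inverse (g x) * frechet_derivative g (at x) v * inverse (g x)))) (at x)"
      if "x \<in> U" for x
      using that by (intro Deriv.has_derivative_inverse C1_on_has_derivative[OF assms(2)] assms(3))
    show "continuous_on U (\<lambda>x. - (inverse (g x) * frechet_derivative g (at x) v * inverse (g x)))" for v
      using assms(2,3) C1_on_continuous[OF assms(2)]
      by (intro continuous_intros C1_on_continuous_derivative) auto
  qed
  then show ?thesis
    using C1_on_mult[OF assms(1)] by (simp add: divide_inverse)
qed

lemma C1_on_compose:
  fixes f :: "'e::euclidean_space \<Rightarrow> 'f::euclidean_space"
  assumes "C1_on U f" "C1_on V g" "f ` U \<subseteq> V"
  shows "C1_on U (\<lambda>x. g (f x))"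
proof (rule C1_onI)
  fix x assume "x \<in> U"
  then have "f x \<in> V"
    using assms by auto
  \<comment> \<open>\<open>C1_on\<close> gives continuity of a derivative only in a fixed direction.
    Here the direction moves with \<open>x\<close>, so it is expanded in the basis: fixed directions
    with continuous coefficients remain.\<close>
  then have eq: "frechet_derivative g (at (f x)) w =
      (\<Sum>b\<in>Basis. (w \<bullet> b) *\<^sub>R frechet_derivative g (at (f x)) b)" for w
    using linear_sum[OF C1_on_linear[OF assms(2)], of "f x" "\<lambda>b. (w \<bullet> b) *\<^sub>R b" Basis]
    by (simp add: euclidean_representation linear_scale[OF C1_on_linear[OF assms(2)]])
  have "((\<lambda>x. g (f x)) has_derivative
      (\<lambda>v. frechet_derivative g (at (f x)) (frechet_derivative f (at x) v))) (at x)"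
    using has_derivative_compose[OF C1_on_has_derivative[OF assms(1) \<open>x \<in> U\<close>]]
      C1_on_has_derivative[OF assms(2) \<open>f x \<in> V\<close>] by auto
  then show "((\<lambda>x. g (f x)) has_derivative
      (\<lambda>v. \<Sum>b\<in>Basis. (frechet_derivative f (at x) v \<bullet> b) *\<^sub>R
          frechet_derivative g (at (f x)) b)) (at x)"
    by (subst eq[symmetric])
next
  have "continuous_on U (\<lambda>x. frechet_derivative g (at (f x)) b)" for b
    using continuous_on_compose2[OF C1_on_continuous_derivative[OF assms(2)]
        C1_on_continuous[OF assms(1)] assms(3)] .
  then show "continuous_on U (\<lambda>x. \<Sum>b\<in>Basis. (frechet_derivative f (at x) v \<bullet> b) *\<^sub>R
          frechet_derivative g (at (f x)) b)" for v
    using assms by (auto intro!: continuous_intros C1_on_continuous_derivative)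
qed

lemma continuous_on_frechet_derivative:
  fixes f :: "'e::euclidean_space \<Rightarrow> 'f::real_normed_vector"
  assumes "C1_on U f" "continuous_on U g"
  shows "continuous_on U (\<lambda>x. frechet_derivative f (at x) (g x))"
proof -
  have "frechet_derivative f (at x) (g x) =
      (\<Sum>b\<in>Basis. (g x \<bullet> b) *\<^sub>R frechet_derivative f (at x) b)" if "x \<in> U" for x
    using linear_sum[OF C1_on_linear[OF assms(1) that], of "\<lambda>b. (g x \<bullet> b) *\<^sub>R b" Basis]
    by (simp add: euclidean_representation linear_scale[OF C1_on_linear[OF assms(1) that]])
  moreover have "continuous_on U (\<lambda>x. \<Sum>b\<in>Basis. (g x \<bullet> b) *\<^sub>R frechet_derivative f (at x) b)"
    using assms by (auto intro!: continuous_intros C1_on_continuous_derivative)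
  ultimately show ?thesis
    by (simp cong: continuous_on_cong)
qed

lemma smooth_on_C1: "smooth_on U f \<Longrightarrow> C1_on U f"
  unfolding smooth_on_def by blast

section \<open>Integrals of derivatives and symmetry of second derivatives\<close>

lemma frechet_derivative_outside_support:
  fixes f :: "'e::euclidean_space \<Rightarrow> 'f::real_normed_vector"
  assumes "closed K" "\<And>x. x \<notin> K \<Longrightarrow> f x = 0" "x \<notin> K"
  shows "frechet_derivative f (at x) v = 0"
proof -
  have "(f has_derivative (\<lambda>v. 0)) (at x)"
    by (rule has_derivative_transform_within_open[of "\<lambda>x. 0", where s = "- K"]) (use assms in auto)
  then show ?thesis
    using frechet_derivative_at by metis
qed

lemma C1_on_line_derivative:
  fixes F :: "'e::euclidean_space \<Rightarrow> real"
  assumes "C1_on U F" "x + t *\<^sub>R v \<in> U"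
  shows "((\<lambda>s. F (x + s *\<^sub>R v)) has_real_derivative frechet_derivative F (at (x + t *\<^sub>R v)) v) (at t)"
proof -
  define y where "y = (\<lambda>s. x + s *\<^sub>R v)"
  have "y t \<in> U"
    using assms by (simp add: y_def)
  moreover have "(y has_derivative (\<lambda>h. h *\<^sub>R v)) (at t)"
    unfolding y_def by (auto intro!: derivative_eq_intros)
  ultimately have "((\<lambda>s. F (y s)) has_derivative (\<lambda>h. frechet_derivative F (at (y t)) (h *\<^sub>R v))) (at t)"
    using has_derivative_compose C1_on_has_derivative assms(1) by blast
  then show ?thesis
    using linear_scale[OF C1_on_linear[OF assms(1) \<open>y t \<in> U\<close>]]
    by (simp add: has_field_derivative_def y_def mult_commute_abs)
qed

lemma C1_on_line_mvt:
  fixes F :: "'e::euclidean_space \<Rightarrow> real"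
  assumes "C1_on U F" "0 < t" "\<And>s. 0 \<le> s \<Longrightarrow> s \<le> t \<Longrightarrow> x + s *\<^sub>R v \<in> U"
  obtains s where "0 < s" "s < t"
    "F (x + t *\<^sub>R v) - F x = t * frechet_derivative F (at (x + s *\<^sub>R v)) v"
  using MVT2[OF \<open>0 < t\<close> C1_on_line_derivative[OF assms(1) assms(3)]] that by auto

text \<open>By translation invariance of Lebesgue measure every difference quotient of
  \<open>F\<close> in direction \<open>v\<close> has integral 0, and dominated convergence carries
  this over to the derivative.\<close>

lemma has_integral_derivative_compact_support:
  fixes F :: "'e::euclidean_space \<Rightarrow> real"
  assumes F: "C1_on UNIV F" and K: "compact K" "\<And>x. x \<notin> K \<Longrightarrow> F x = 0"
  shows "((\<lambda>x. frechet_derivative F (at x) v) has_integral 0) UNIV"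
proof -
  define D where "D = (\<lambda>x. frechet_derivative F (at x) v)"
  have contD: "continuous_on UNIV D"
    unfolding D_def using F by (rule C1_on_continuous_derivative)
  have contF: "continuous_on UNIV F"
    using F by (rule C1_on_continuous)
  have D0: "D x = 0" if "x \<notin> K" for x
    unfolding D_def by (rule frechet_derivative_outside_support[OF compact_imp_closed[OF K(1)]])
      (use K that in auto)
  have "bounded (D ` K)"
    using K(1) contD by (intro compact_imp_bounded compact_continuous_image)
      (auto intro: continuous_on_subset)
  then obtain B where B: "\<And>x. x \<in> K \<Longrightarrow> \<bar>D x\<bar> \<le> B"
    unfolding bounded_iff by auto
  have B: "\<bar>D x\<bar> \<le> max B 0" for x
    using B[of x] D0[of x] by (cases "x \<in> K") auto
  obtain r where r: "\<And>x. x \<in> K \<Longrightarrow> norm x \<le> r"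
    using compact_imp_bounded[OF K(1)] unfolding bounded_iff by auto
  define f where "f = (\<lambda>n x. (F (x + inverse (real (Suc n)) *\<^sub>R v) - F x) * real (Suc n))"
  \<comment> \<open>The dominating function. By the mean value theorem \<open>f n x\<close> is a
    value of \<open>D\<close> at some \<open>x + s v\<close> with 0 < s < 1 / (n + 1), and it is 0
    unless that point lies in \<open>K\<close>, which forces |x| to be at most
    \<open>r + norm v\<close>.\<close>
  define w where "w = (\<lambda>x. max B 0 * indicat_real (cball 0 (r + norm v) :: 'e set) x)"
  have intF: "integrable lborel F"
  proof -
    have "integrable lborel (\<lambda>x. indicator K x *\<^sub>R F x)"
      using K(1) contF by (intro borel_integrable_compact) (auto intro: continuous_on_subset)
    moreover have "(\<lambda>x. indicator K x *\<^sub>R F x) = F"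
      using K(2) by (auto simp: fun_eq_iff indicator_def)
    ultimately show ?thesis by simp
  qed
  have intFs: "integrable lborel (\<lambda>x. F (x + a))" and
    eqFs: "integral\<^sup>L lborel (\<lambda>x. F (x + a)) = integral\<^sup>L lborel F" for a
  proof -
    have "integrable (distr lborel borel ((+) a)) F"
      using intF by (simp only: lborel_distr_plus)
    then show "integrable lborel (\<lambda>x. F (x + a))"
      using integrable_distr_eq[of "(+) a" lborel borel F] contF
      by (simp add: add.commute borel_measurable_continuous_onI)
    have "integral\<^sup>L (distr lborel borel ((+) a)) F = integral\<^sup>L lborel (\<lambda>x. F (a + x))"
      using contF by (intro integral_distr) (auto simp: borel_measurable_continuous_onI)
    then show "integral\<^sup>L lborel (\<lambda>x. F (x + a)) = integral\<^sup>L lborel F"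
      by (simp add: lborel_distr_plus add.commute)
  qed
  have intf: "integral\<^sup>L lborel (f n) = 0" for n
    unfolding f_def using intF intFs eqFs by simp
  have diff: "\<exists>s. 0 < s \<and> s < inverse (real (Suc n)) \<and> f n x = D (x + s *\<^sub>R v)" for n x
  proof -
    obtain s where "0 < s" "s < inverse (real (Suc n))"
      "F (x + inverse (real (Suc n)) *\<^sub>R v) - F x = inverse (real (Suc n)) * D (x + s *\<^sub>R v)"
      using C1_on_line_mvt[OF F, of "inverse (real (Suc n))" x v] unfolding D_def by auto
    then show ?thesis
      unfolding f_def by (intro exI[of _ s]) (simp add: field_simps)
  qed
  have lim: "(\<lambda>n. f n x) \<longlonglongrightarrow> D x" for x
  proof -
    obtain s where s: "\<And>n. 0 < s n \<and> s n < inverse (real (Suc n)) \<and> f n x = D (x + s n *\<^sub>R v)"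
      using diff[of _ x] by metis
    have "s \<longlonglongrightarrow> 0"
      by (rule tendsto_sandwich[OF _ _ tendsto_const LIMSEQ_inverse_real_of_nat])
        (use s in \<open>auto intro!: always_eventually less_imp_le\<close>)
    then have "(\<lambda>n. x + s n *\<^sub>R v) \<longlonglongrightarrow> x + 0 *\<^sub>R v"
      by (intro tendsto_intros)
    then have "(\<lambda>n. D (x + s n *\<^sub>R v)) \<longlonglongrightarrow> D x"
      using continuous_on_tendsto_compose[OF contD] by auto
    then show ?thesis
      using s by simp
  qed
  have bound: "norm (f n x) \<le> w x" for n x
  proof -
    obtain s where s: "0 < s" "s < inverse (real (Suc n))" "f n x = D (x + s *\<^sub>R v)"
      using diff by blast
    show ?thesis
    proof (cases "x + s *\<^sub>R v \<in> K")
      case True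
      have "inverse (real (Suc n)) \<le> 1"
        by (simp add: field_simps)
      then have "s \<le> 1"
        using s by simp
      have "norm x \<le> norm (x + s *\<^sub>R v) + norm (s *\<^sub>R v)"
        using norm_triangle_ineq4[of "x + s *\<^sub>R v" "s *\<^sub>R v"] by simp
      also have "\<dots> \<le> r + norm v"
        using r[OF True] mult_right_mono[OF \<open>s \<le> 1\<close> norm_ge_zero[of v]] s(1) by simp
      finally show ?thesis
        unfolding s w_def using B by simp
    next
      case False
      then show ?thesis
        unfolding s w_def by (simp add: D0)
    qed
  qed
  have meas: "D \<in> borel_measurable lborel" "\<And>n. f n \<in> borel_measurable lborel"
  proof -
    show "D \<in> borel_measurable lborel"
      using borel_measurable_continuous_onI[OF contD] by simp
    have "continuous_on UNIV (\<lambda>x. F (x + a))" for a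
      by (rule continuous_on_compose2[OF contF]) (auto intro!: continuous_intros)
    then have "continuous_on UNIV (f n)" for n
      unfolding f_def using contF by (intro continuous_on_mult_right continuous_on_diff)
    then show "f n \<in> borel_measurable lborel" for n
      using borel_measurable_continuous_onI[of "f n"] by simp
  qed
  have intw: "integrable lborel w"
  proof -
    have "emeasure lborel (cball (0::'e) (r + norm v)) < \<infinity>"
      by (rule emeasure_bounded_finite) (rule bounded_cball)
    then have "integrable lborel (indicat_real (cball (0::'e) (r + norm v)))"
      by (intro integrable_real_indicator) simp_all
    then show ?thesis
      unfolding w_def by (rule integrable_mult_right)
  qed
  have intD: "integrable lborel D"
    by (rule integrable_dominated_convergence[OF meas intw AE_I2 AE_I2, OF lim bound])
  have limD: "(\<lambda>n. integral\<^sup>L lborel (f n)) \<longlonglongrightarrow> integral\<^sup>L lborel D"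
    by (rule integral_dominated_convergence[OF meas intw AE_I2 AE_I2, OF lim bound])
  have "integral\<^sup>L lborel D = 0"
    using LIMSEQ_unique[OF limD] intf by simp
  then show ?thesis
    using has_integral_integral_lborel[OF intD] unfolding D_def by simp
qed

text \<open>The second difference over a small parallelogram is symmetric in \<open>u\<close> and
  \<open>v\<close>, and two applications of the mean value theorem express it through either mixed
  derivative. It is used for d(d\<alpha>) = 0.\<close>

lemma frechet_derivative_symmetric:
  fixes f :: "'e::euclidean_space \<Rightarrow> real"
  assumes U: "open U" "x \<in> U" and f: "Ck_on 2 U f"
  shows "frechet_derivative (\<lambda>y. frechet_derivative f (at y) u) (at x) v =
    frechet_derivative (\<lambda>y. frechet_derivative f (at y) v) (at x) u"
proof -
  define D where "D = (\<lambda>u y. frechet_derivative f (at y) u)"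
  define DD where "DD = (\<lambda>u v y. frechet_derivative (D u) (at y) v)"
  have C1: "C1_on U f" and C1D: "C1_on U (D u)" for u
    using f unfolding numeral_2_eq_2 D_def
    by (auto simp: Ck_on.simps continuous_on_eq_continuous_within continuous_at_imp_continuous_at_within
      differentiable_imp_continuous_within)
  have cont: "continuous_on U (DD u v)" for u v
    unfolding DD_def using C1D by (rule C1_on_continuous_derivative)
  obtain e where e: "e > 0" "ball x e \<subseteq> U"
    using U openE by blast
  \<comment> \<open>The factor keeps the parallelogram with sides \<open>h n u\<close> and
    \<open>h n v\<close> inside the ball of radius \<open>e\<close>; the 1 in the denominator covers
    the case that both vectors are 0.\<close>
  define h where "h = (\<lambda>n. e / (norm u + norm v + 1) * inverse (real (Suc n)))"
  have h: "h n > 0" "h n * (norm u + norm v) < e" for n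
  proof -
    have p: "0 < norm u + norm v + 1"
      using norm_ge_zero[of u] norm_ge_zero[of v] by linarith
    then show "h n > 0"
      unfolding h_def using e by simp
    have "h n \<le> e / (norm u + norm v + 1)"
      unfolding h_def using e p by (intro mult_right_le_one_le) (auto simp: field_simps)
    then have "h n * (norm u + norm v) \<le> e / (norm u + norm v + 1) * (norm u + norm v)"
      by (rule mult_right_mono) simp
    also have "\<dots> < e"
      using e p by (simp add: field_simps)
    finally show "h n * (norm u + norm v) < e" .
  qed
  have inU: "x + a *\<^sub>R u + b *\<^sub>R v \<in> U" if "0 \<le> a" "a \<le> h n" "0 \<le> b" "b \<le> h n" for a b n
  proof -
    have "norm (a *\<^sub>R u + b *\<^sub>R v) \<le> a * norm u + b * norm v"
      using that norm_triangle_ineq[of "a *\<^sub>R u" "b *\<^sub>R v"] by simp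
    also have "\<dots> \<le> h n * norm u + h n * norm v"
      using that by (intro add_mono mult_right_mono) auto
    also have "\<dots> < e"
      using h(2)[of n] by (simp add: distrib_left)
    finally have "x + (a *\<^sub>R u + b *\<^sub>R v) \<in> ball x e"
      by (simp only: mem_ball dist_norm norm_minus_commute[of x] add_diff_cancel_left')
    then show ?thesis
      using e(2) by (auto simp: add.assoc)
  qed
  let ?P = "\<lambda>u v n a b. 0 < a \<and> a < h n \<and> 0 < b \<and> b < h n \<and>
      f (x + h n *\<^sub>R u + h n *\<^sub>R v) - f (x + h n *\<^sub>R u) - f (x + h n *\<^sub>R v) + f x =
      h n * h n * DD u v (x + a *\<^sub>R u + b *\<^sub>R v)"
  \<comment> \<open>The inclusion in \<open>U\<close> is a premise here, so that the same argument
    also serves with \<open>u\<close> and \<open>v\<close> exchanged.\<close>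
  have main: "\<exists>a b. ?P u v n a b"
    if inU: "\<And>a b. 0 \<le> a \<Longrightarrow> a \<le> h n \<Longrightarrow> 0 \<le> b \<Longrightarrow> b \<le> h n \<Longrightarrow> x + a *\<^sub>R u + b *\<^sub>R v \<in> U" for n u v
  proof -
    define g where "g = (\<lambda>t. f (x + t *\<^sub>R u + h n *\<^sub>R v) - f (x + t *\<^sub>R u))"
    have h0: "0 \<le> h n" "0 < h n"
      using h(1)[of n] by auto
    have "(g has_real_derivative D u (x + t *\<^sub>R u + h n *\<^sub>R v) - D u (x + t *\<^sub>R u)) (at t)"
      if "0 \<le> t" "t \<le> h n" for t
    proof -
      have 1: "x + t *\<^sub>R u + h n *\<^sub>R v \<in> U" "x + t *\<^sub>R u \<in> U"
        using inU[of t "h n"] inU[of t 0] that h0 by auto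
      then show ?thesis
        using DERIV_diff[OF C1_on_line_derivative[OF C1, of "x + h n *\<^sub>R v" t u]
            C1_on_line_derivative[OF C1, of x t u]]
        unfolding g_def D_def by (simp add: add_ac)
    qed
    from MVT2[OF h0(2) this] obtain a where a: "0 < a" "a < h n"
      "g (h n) - g 0 = h n * (D u (x + a *\<^sub>R u + h n *\<^sub>R v) - D u (x + a *\<^sub>R u))"
      by auto
    have "\<And>s. 0 \<le> s \<Longrightarrow> s \<le> h n \<Longrightarrow> (x + a *\<^sub>R u) + s *\<^sub>R v \<in> U"
      using inU a by auto
    from C1_on_line_mvt[OF C1D h0(2) this] obtain b where b: "0 < b" "b < h n"
      "D u (x + a *\<^sub>R u + h n *\<^sub>R v) - D u (x + a *\<^sub>R u) = h n * DD u v (x + a *\<^sub>R u + b *\<^sub>R v)"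
      unfolding DD_def by blast
    show ?thesis
      by (intro exI[of _ a] exI[of _ b]) (use a b in \<open>simp add: g_def algebra_simps\<close>)
  qed
  have "\<exists>a b. ?P u v n a b" for n
    by (rule main) (rule inU)
  then obtain a b where ab: "\<And>n. ?P u v n (a n) (b n)"
    by metis
  have inU': "0 \<le> a \<Longrightarrow> a \<le> h n \<Longrightarrow> 0 \<le> b \<Longrightarrow> b \<le> h n \<Longrightarrow> x + a *\<^sub>R v + b *\<^sub>R u \<in> U" for a b n
    using inU[of b n a] by (simp add: algebra_simps)
  have "\<exists>a b. ?P v u n a b" for n
    by (rule main) (rule inU')
  then obtain c d where cd: "\<And>n. ?P v u n (c n) (d n)"
    by metis
  \<comment> \<open>Both sides, multiplied by the square of \<open>h n\<close>, are the same second
    difference.\<close>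
  have "DD u v (x + a n *\<^sub>R u + b n *\<^sub>R v) = DD v u (x + c n *\<^sub>R v + d n *\<^sub>R u)" for n
  proof -
    have "h n * h n * DD u v (x + a n *\<^sub>R u + b n *\<^sub>R v) = h n * h n * DD v u (x + c n *\<^sub>R v + d n *\<^sub>R u)"
      using ab[of n] cd[of n] by (simp add: algebra_simps)
    then show ?thesis
      using h(1)[of n] by simp
  qed
  moreover have "h \<longlonglongrightarrow> 0"
    unfolding h_def using tendsto_mult_right_zero[OF LIMSEQ_inverse_real_of_nat] by blast
  then have lim0: "s \<longlonglongrightarrow> 0" if "\<And>n. 0 < s n \<and> s n < h n" for s
    by (rule tendsto_sandwich[OF _ _ tendsto_const, rotated 2])
      (use that in \<open>auto intro!: always_eventually less_imp_le\<close>)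
  have "(\<lambda>n. DD w z (x + s n *\<^sub>R w + t n *\<^sub>R z)) \<longlonglongrightarrow> DD w z x"
    if "\<And>n. 0 < s n \<and> s n < h n" "\<And>n. 0 < t n \<and> t n < h n"
      "\<And>n. x + s n *\<^sub>R w + t n *\<^sub>R z \<in> U" for w z s t
  proof (rule continuous_on_tendsto_compose[OF cont _ U(2)])
    have "(\<lambda>n. x + s n *\<^sub>R w + t n *\<^sub>R z) \<longlonglongrightarrow> x + 0 *\<^sub>R w + 0 *\<^sub>R z"
      using lim0[OF that(1)] lim0[OF that(2)] by (intro tendsto_intros)
    then show "(\<lambda>n. x + s n *\<^sub>R w + t n *\<^sub>R z) \<longlonglongrightarrow> x"
      by simp
  qed (use that in auto)
  note lim = this
  have "(\<lambda>n. DD u v (x + a n *\<^sub>R u + b n *\<^sub>R v)) \<longlonglongrightarrow> DD u v x"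
  proof (rule lim)
    show "x + a n *\<^sub>R u + b n *\<^sub>R v \<in> U" for n
      using ab[of n] by (intro inU[of _ n] less_imp_le) blast+
  qed (use ab in blast)+
  moreover have "(\<lambda>n. DD v u (x + c n *\<^sub>R v + d n *\<^sub>R u)) \<longlonglongrightarrow> DD v u x"
  proof (rule lim)
    show "x + c n *\<^sub>R v + d n *\<^sub>R u \<in> U" for n
      using cd[of n] by (intro inU'[of _ n] less_imp_le) blast+
  qed (use cd in blast)+
  ultimately have "DD u v x = DD v u x"
    by (auto intro: LIMSEQ_unique)
  then show ?thesis
    unfolding DD_def D_def .
qed

section \<open>Integration on closed manifolds\<close>

lemma has_real_derivative_max_square:
  "((\<lambda>t::real. (max 0 t)\<^sup>2) has_real_derivative 2 * max 0 t) (at t)"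
proof -
  consider "t > 0" | "t < 0" | "t = 0" by linarith
  then show ?thesis
  proof cases
    case 1
    have "((\<lambda>t. t\<^sup>2) has_real_derivative 2 * max 0 t) (at t)"
      using 1 by (auto intro!: derivative_eq_intros)
    then show ?thesis
      by (rule has_field_derivative_transform_within_open[where S = "{0<..}"]) (use 1 in auto)
  next
    case 2
    have "((\<lambda>t. 0) has_real_derivative 2 * max 0 t) (at t)"
      using 2 by (auto intro!: derivative_eq_intros)
    then show ?thesis
      by (rule has_field_derivative_transform_within_open[where S = "{..<0}"]) (use 2 in auto)
  next
    case 3
    have "((\<lambda>s. max 0 s) \<longlongrightarrow> (0::real)) (at 0)"
      using tendsto_max[OF tendsto_const[of 0] tendsto_ident_at[of "0::real" UNIV]] by simp
    then have "((\<lambda>s. ((max 0 s)\<^sup>2 - (max 0 0)\<^sup>2) / (s - 0)) \<longlongrightarrow> (0::real)) (at 0)"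
      by (rule Lim_transform_eventually)
        (auto simp: eventually_at_filter max_def power2_eq_square)
    then show ?thesis
      unfolding 3 has_field_derivative_iff by simp
  qed
qed

text \<open>The positive part of r^2 - |x - a|^2 has a kink on the sphere; its square is
  continuously differentiable, which is enough because the partition of unity is differentiated only
  once.\<close>

definition bump :: "'e::euclidean_space \<Rightarrow> real \<Rightarrow> 'e \<Rightarrow> real" where
  "bump a r x = (max 0 (r\<^sup>2 - (x - a) \<bullet> (x - a)))\<^sup>2"

lemma C1_on_bump: "C1_on U (bump a r)"
proof (rule C1_onI)
  fix x
  have "((\<lambda>x. r\<^sup>2 - (x - a) \<bullet> (x - a)) has_derivative (\<lambda>v. - 2 * ((x - a) \<bullet> v))) (at x)"
    by (auto intro!: derivative_eq_intros simp: inner_commute algebra_simps)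
  from has_derivative_compose[OF this has_real_derivative_max_square[unfolded has_field_derivative_def]]
  show "(bump a r has_derivative
      (\<lambda>v. 2 * max 0 (r\<^sup>2 - (x - a) \<bullet> (x - a)) * (- 2 * ((x - a) \<bullet> v)))) (at x)"
    unfolding bump_def .
qed (intro continuous_intros)

lemma bump_nonneg: "0 \<le> bump a r x"
  by (simp add: bump_def)

lemma bump_pos: "x \<in> ball a r \<Longrightarrow> 0 < bump a r x"
proof -
  assume "x \<in> ball a r"
  then have "norm (x - a) < r"
    by (simp add: dist_norm norm_minus_commute)
  then have "(norm (x - a))\<^sup>2 < r\<^sup>2"
    by (intro power_strict_mono) auto
  then show ?thesis
    by (simp add: bump_def power2_norm_eq_inner)
qed

lemma bump_outside: "0 \<le> r \<Longrightarrow> x \<notin> ball a r \<Longrightarrow> bump a r x = 0"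
proof -
  assume "0 \<le> r" "x \<notin> ball a r"
  then have "r \<le> norm (x - a)"
    by (simp add: dist_norm norm_minus_commute)
  then have "r\<^sup>2 \<le> (norm (x - a))\<^sup>2"
    using \<open>0 \<le> r\<close> by (intro power_mono) auto
  then show ?thesis
    by (simp add: bump_def power2_norm_eq_inner)
qed

section \<open>Integration on open subsets of Euclidean space\<close>

lemma absolutely_integrable_compact_support:
  fixes f :: "'e::euclidean_space \<Rightarrow> real"
  assumes "compact K" "K \<subseteq> U" "continuous_on U f" "\<And>x. x \<in> U \<Longrightarrow> x \<notin> K \<Longrightarrow> f x = 0"
  shows "f absolutely_integrable_on U"
proof -
  have "integrable lborel (\<lambda>x. indicator K x *\<^sub>R f x)"
    using assms by (intro borel_integrable_compact) (auto intro: continuous_on_subset)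
  then have "integrable lebesgue (\<lambda>x. indicator K x *\<^sub>R f x)"
    by (subst integrable_completion) (auto dest: borel_measurable_integrable)
  moreover have "(\<lambda>x. indicator K x *\<^sub>R f x) = (\<lambda>x. indicator U x *\<^sub>R f x)"
    using assms by (auto simp: fun_eq_iff indicator_def)
  ultimately show ?thesis
    by (simp add: set_integrable_def)
qed

text \<open>Real values are treated as vectors in \<open>real ^ 1\<close>, the setting in which
  \<open>integral_change_of_variables\<close> is applied.\<close>

lemma integral_change_of_variables_real:
  fixes f :: "real ^ 'n::{finite,wellorder} \<Rightarrow> real" and g :: "real ^ 'n::_ \<Rightarrow> real ^ 'n::_"
  assumes "open S" and "\<And>x. x \<in> S \<Longrightarrow> (g has_derivative g' x) (at x)" and "inj_on g S"
    and "(\<lambda>x. \<bar>det (matrix (g' x))\<bar> * f (g x)) absolutely_integrable_on S"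
  shows "integral (g ` S) f = integral S (\<lambda>x. \<bar>det (matrix (g' x))\<bar> * f (g x))"
proof -
  have "(\<lambda>x. \<bar>det (matrix (g' x))\<bar> *\<^sub>R (vec (f (g x)) :: real^1)) absolutely_integrable_on S"
    using assms(4) by (simp add: absolutely_integrable_on_1_iff)
  from integral_change_of_variables[OF _ _ assms(3), of g' "\<lambda>x. vec (f x) :: real^1", OF _ _ disjI2, OF _ _ this]
  have "integral (g ` S) (\<lambda>x. vec (f x) :: real^1) = integral S (\<lambda>x. \<bar>det (matrix (g' x))\<bar> *\<^sub>R (vec (f (g x)) :: real^1))"
    using assms(1,2) by (auto intro: has_derivative_at_withinI simp: borel_open)
  then show ?thesis
    by (simp add: integral_on_1_eq vec_eq_iff)
qed

definition divergence :: "(real ^ 'n \<Rightarrow> real ^ 'n) \<Rightarrow> real ^ 'n \<Rightarrow> real" where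
  "divergence Y x = (\<Sum>i\<in>UNIV. frechet_derivative Y (at x) (axis i 1) $ i)"

text \<open>The integrand is the divergence of the product \<rho> Y. Extended by zero this product
  is continuously differentiable on \<open>U\<close> and on \<open>- K\<close>, which together cover
  the space, so each of its partial derivatives has integral 0.\<close>

lemma has_integral_divergence:
  fixes Y :: "real ^ 'n \<Rightarrow> real ^ 'n"
  assumes U: "open U" and Y: "C1_on U Y" and \<rho>: "C1_on U \<rho>"
    and K: "compact K" "K \<subseteq> U" "\<And>x. x \<in> U \<Longrightarrow> x \<notin> K \<Longrightarrow> \<rho> x = 0"
  shows "((\<lambda>x. frechet_derivative \<rho> (at x) (Y x) + \<rho> x * divergence Y x) has_integral 0) U"
proof -
  define F where "F = (\<lambda>i x. if x \<in> U then \<rho> x * Y x $ i else 0)"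
  have deriv: "((\<lambda>x. Y x $ i) has_derivative (\<lambda>v. frechet_derivative Y (at x) v $ i)) (at x)"
    if "x \<in> U" for x i
    using bounded_linear.has_derivative[OF bounded_linear_vec_nth C1_on_has_derivative[OF Y that]] .
  have C1Y: "C1_on U (\<lambda>x. Y x $ i)" for i
    by (rule C1_onI[OF deriv], assumption) (intro continuous_on_component C1_on_continuous_derivative[OF Y])
  have "C1_on U (F i)" for i
    by (rule C1_on_cong[OF U C1_on_mult[OF \<rho> C1Y[of i]]]) (simp add: F_def)
  moreover have "C1_on (- K) (F i)" for i
    by (rule C1_on_cong[OF _ C1_on_const[of _ 0]]) (use K in \<open>auto simp: F_def compact_imp_closed\<close>)
  ultimately have "C1_on (U \<union> - K) (F i)" for i
    using U K by (intro C1_on_Un) (auto simp: compact_imp_closed)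
  moreover have "U \<union> - K = UNIV"
    using K by auto
  ultimately have C1F: "C1_on UNIV (F i)" for i
    by simp
  have F0: "F i x = 0" if "x \<notin> K" for i x
    using K that by (auto simp: F_def)
  have "((\<lambda>x. \<Sum>i\<in>UNIV. frechet_derivative (F i) (at x) (axis i 1)) has_integral (\<Sum>i\<in>(UNIV::'n set). 0)) UNIV"
    by (rule has_integral_sum[OF finite]) (rule has_integral_derivative_compact_support[OF C1F K(1) F0])
  moreover have "(\<Sum>i\<in>UNIV. frechet_derivative (F i) (at x) (axis i 1)) =
      (if x \<in> U then frechet_derivative \<rho> (at x) (Y x) + \<rho> x * divergence Y x else 0)" for x
  proof (cases "x \<in> U")
    case True
    have "(F i has_derivative (\<lambda>v. \<rho> x * frechet_derivative Y (at x) v $ i +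
        frechet_derivative \<rho> (at x) v * Y x $ i)) (at x)" for i
      by (rule has_derivative_transform_within_open[OF has_derivative_mult[OF
          C1_on_has_derivative[OF \<rho> True] deriv[OF True, of i]] U True]) (simp add: F_def)
    then have "frechet_derivative (F i) (at x) = (\<lambda>v. \<rho> x * frechet_derivative Y (at x) v $ i +
        frechet_derivative \<rho> (at x) v * Y x $ i)" for i
      by (rule frechet_derivative_at[symmetric])
    moreover have "frechet_derivative \<rho> (at x) (Y x) =
        (\<Sum>i\<in>UNIV. frechet_derivative \<rho> (at x) (axis i 1) * Y x $ i)"
    proof -
      have lin: "linear (frechet_derivative \<rho> (at x))"
        using \<rho> True by (rule C1_on_linear)
      have "Y x = (\<Sum>i\<in>UNIV. (Y x $ i) *\<^sub>R axis i 1)"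
        using basis_expansion[of "Y x"] by (simp add: scalar_mult_eq_scaleR)
      then have "frechet_derivative \<rho> (at x) (Y x) =
          frechet_derivative \<rho> (at x) (\<Sum>i\<in>UNIV. (Y x $ i) *\<^sub>R axis i 1)"
        by (rule arg_cong)
      also have "\<dots> = (\<Sum>i\<in>UNIV. frechet_derivative \<rho> (at x) (axis i 1) * Y x $ i)"
        unfolding linear_sum[OF lin] linear_scale[OF lin] by (simp add: mult.commute)
      finally show ?thesis .
    qed
    ultimately show ?thesis
      using True by (simp add: divergence_def sum.distrib sum_distrib_left)
  next
    case False
    then have "x \<notin> K"
      using K by auto
    then show ?thesis
      using False frechet_derivative_outside_support[OF compact_imp_closed[OF K(1)] F0] by simp
  qed
  ultimately show ?thesis
    by (simp add: has_integral_restrict_UNIV)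
qed

section \<open>Charts, transition maps and functions on a manifold\<close>

locale manifold =
  fixes X :: "'a topology" and A :: "('a, 'e::euclidean_space) chart set"
  assumes smooth_manifold: "smooth_manifold X A"
begin

lemma openin_chart: "c \<in> A \<Longrightarrow> openin X (fst c)"
  and open_chart_image: "c \<in> A \<Longrightarrow> open (chart_image c)"
  and homeomorphic_chart:
    "c \<in> A \<Longrightarrow> homeomorphic_map (subtopology X (fst c)) (top_of_set (chart_image c)) (snd c)"
  and topspace_eq: "(\<Union>c\<in>A. fst c) = topspace X"
  and Hausdorff: "Hausdorff_space X"
  and smooth_transition: "c \<in> A \<Longrightarrow> c' \<in> A \<Longrightarrow> smooth_on (overlap c c') (transition c c')"
  using smooth_manifold by (auto simp: smooth_manifold_def is_chart_def)

lemma chart_subset: "c \<in> A \<Longrightarrow> fst c \<subseteq> topspace X"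
  using openin_chart openin_subset by blast

lemma topspace_chart: "c \<in> A \<Longrightarrow> topspace (subtopology X (fst c)) = fst c"
  using chart_subset[of c] by (auto simp: topspace_subtopology)

lemma inj_on_chart: "c \<in> A \<Longrightarrow> inj_on (snd c) (fst c)"
  using homeomorphic_imp_injective_map[OF homeomorphic_chart] topspace_chart by fastforce

lemma chart_inv_chart [simp]: "c \<in> A \<Longrightarrow> q \<in> fst c \<Longrightarrow> chart_inv c (snd c q) = q"
  unfolding chart_inv_def by (simp add: inj_on_chart inv_into_f_f)

lemma chart_chart_inv [simp]: "x \<in> chart_image c \<Longrightarrow> snd c (chart_inv c x) = x"
  unfolding chart_inv_def chart_image_def by (rule f_inv_into_f)

lemma chart_inv_in [simp]: "x \<in> chart_image c \<Longrightarrow> chart_inv c x \<in> fst c"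
  unfolding chart_inv_def chart_image_def by (rule inv_into_into)

lemma chart_in_image [simp]: "q \<in> fst c \<Longrightarrow> snd c q \<in> chart_image c"
  unfolding chart_image_def by simp

lemma continuous_map_chart:
  "c \<in> A \<Longrightarrow> continuous_map (subtopology X (fst c)) (top_of_set (chart_image c)) (snd c)"
  using homeomorphic_chart by (rule homeomorphic_imp_continuous_map)

lemma continuous_map_chart_inv:
  assumes "c \<in> A"
  shows "continuous_map (top_of_set (chart_image c)) (subtopology X (fst c)) (chart_inv c)"
proof -
  obtain g where g: "homeomorphic_maps (subtopology X (fst c)) (top_of_set (chart_image c)) (snd c) g"
    using homeomorphic_chart[OF assms] homeomorphic_map_maps by blast
  have "g x = chart_inv c x" if "x \<in> chart_image c" for x
  proof -
    have "g x \<in> fst c" "snd c (g x) = x"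
      using g that assms topspace_chart[OF assms]
      by (auto simp: homeomorphic_maps_def continuous_map_def)
    then show ?thesis
      using chart_inv_chart[OF assms] by metis
  qed
  then show ?thesis
    using g by (auto simp: homeomorphic_maps_def intro: continuous_map_eq)
qed

lemma openin_chart_preimage:
  assumes "c \<in> A" "open W"
  shows "openin X {q \<in> fst c. snd c q \<in> W}"
proof -
  have "openin (top_of_set (chart_image c)) (chart_image c \<inter> W)"
    using assms by (auto simp: openin_open)
  then have "openin (subtopology X (fst c)) {q \<in> topspace (subtopology X (fst c)). snd c q \<in> chart_image c \<inter> W}"
    by (rule openin_continuous_map_preimage[OF continuous_map_chart[OF assms(1)]])
  moreover have "{q \<in> topspace (subtopology X (fst c)). snd c q \<in> chart_image c \<inter> W} = {q \<in> fst c. snd c q \<in> W}"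
    using topspace_chart[OF assms(1)] by auto
  ultimately show ?thesis
    using openin_open_subtopology[OF openin_chart[OF assms(1)]] by simp
qed

lemma open_chart_of_openin:
  assumes "c \<in> A" "openin X V"
  shows "open (snd c ` (fst c \<inter> V))"
proof -
  have "openin (subtopology X (fst c)) (fst c \<inter> V)"
    using assms by (simp add: openin_subtopology_Int2)
  then have "openin (top_of_set (chart_image c)) (snd c ` (fst c \<inter> V))"
    using homeomorphic_map_openness_eq[OF homeomorphic_chart[OF assms(1)]] by blast
  then show ?thesis
    using open_chart_image[OF assms(1)] by (simp add: openin_open_eq)
qed

lemma open_overlap: "c \<in> A \<Longrightarrow> c' \<in> A \<Longrightarrow> open (overlap c c')"
  unfolding overlap_def by (intro open_chart_of_openin openin_chart)

text \<open>The image is compact, and compact sets are closed because the space is Hausdorff. Hence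
  supports given in one chart have open complements in the whole manifold.\<close>

lemma closedin_chart_inv_image:
  assumes "c \<in> A" "compact K" "K \<subseteq> chart_image c"
  shows "closedin X (chart_inv c ` K)"
proof -
  have "compactin (top_of_set (chart_image c)) K"
    using assms by (simp add: compactin_subtopology)
  then have "compactin (subtopology X (fst c)) (chart_inv c ` K)"
    using image_compactin continuous_map_chart_inv[OF assms(1)] by blast
  then show ?thesis
    using Hausdorff by (simp add: compactin_subtopology compactin_imp_closedin)
qed

lemma overlap_iff:
  assumes "c \<in> A"
  shows "x \<in> overlap c c' \<longleftrightarrow> x \<in> chart_image c \<and> chart_inv c x \<in> fst c'"
proof
  show "x \<in> overlap c c' \<Longrightarrow> x \<in> chart_image c \<and> chart_inv c x \<in> fst c'"
    using assms by (auto simp: overlap_def)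
  assume "x \<in> chart_image c \<and> chart_inv c x \<in> fst c'"
  then show "x \<in> overlap c c'"
    unfolding overlap_def by (intro image_eqI[of _ _ "chart_inv c x"]) auto
qed

lemma chart_inv_transition:
  "c \<in> A \<Longrightarrow> c' \<in> A \<Longrightarrow> x \<in> overlap c c' \<Longrightarrow> chart_inv c' (transition c c' x) = chart_inv c x"
  by (simp add: overlap_iff transition_def)

lemma transition_in_overlap:
  "c \<in> A \<Longrightarrow> c' \<in> A \<Longrightarrow> x \<in> overlap c c' \<Longrightarrow> transition c c' x \<in> overlap c' c"
  by (simp add: overlap_iff transition_def)

lemma transition_transition:
  "c \<in> A \<Longrightarrow> c' \<in> A \<Longrightarrow> x \<in> overlap c c' \<Longrightarrow> transition c' c (transition c c' x) = x"
  by (simp add: overlap_iff transition_def)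

lemma transition_image: "c \<in> A \<Longrightarrow> c' \<in> A \<Longrightarrow> transition c c' ` overlap c c' = overlap c' c"
proof (intro equalityI subsetI)
  fix y assume "c \<in> A" "c' \<in> A" "y \<in> transition c c' ` overlap c c'"
  then show "y \<in> overlap c' c"
    by (elim imageE) (simp add: transition_in_overlap)
next
  fix y assume *: "c \<in> A" "c' \<in> A" "y \<in> overlap c' c"
  show "y \<in> transition c c' ` overlap c c'"
    by (rule image_eqI[of _ _ "transition c' c y"])
      (use * in \<open>simp_all add: transition_transition transition_in_overlap\<close>)
qed

lemma inj_on_transition: "c \<in> A \<Longrightarrow> c' \<in> A \<Longrightarrow> inj_on (transition c c') (overlap c c')"
  by (metis inj_onI transition_transition)

lemma overlap_subset: "c \<in> A \<Longrightarrow> overlap c c' \<subseteq> chart_image c"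
  by (auto simp: overlap_iff)

lemma has_derivative_transition:
  "c \<in> A \<Longrightarrow> c' \<in> A \<Longrightarrow> x \<in> overlap c c' \<Longrightarrow>
    (transition c c' has_derivative frechet_derivative (transition c c') (at x)) (at x)"
  using C1_on_has_derivative smooth_on_C1 smooth_transition by blast

definition C1_map :: "('a \<Rightarrow> real) \<Rightarrow> bool" where
  "C1_map g \<longleftrightarrow> (\<forall>c\<in>A. C1_on (chart_image c) (\<lambda>x. g (chart_inv c x)))"

definition cont_map :: "('a \<Rightarrow> real) \<Rightarrow> bool" where
  "cont_map g \<longleftrightarrow> (\<forall>c\<in>A. continuous_on (chart_image c) (\<lambda>x. g (chart_inv c x)))"

lemma C1_map_cont: "C1_map g \<Longrightarrow> cont_map g"
  unfolding C1_map_def cont_map_def using C1_on_continuous by blast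

text \<open>Seen in another chart, the function is a composition with the transition map on the
  overlap and 0 away from the closed support. These two open sets cover the chart image.\<close>

lemma C1_map_chart_function:
  assumes c: "c \<in> A" and K: "compact K" "K \<subseteq> chart_image c"
    and \<beta>: "C1_on UNIV \<beta>" "\<And>x. x \<notin> K \<Longrightarrow> \<beta> x = 0"
  shows "C1_map (\<lambda>q. if q \<in> fst c then \<beta> (snd c q) else 0)"
  unfolding C1_map_def
proof
  fix c' assume c': "c' \<in> A"
  let ?g = "\<lambda>x. if chart_inv c' x \<in> fst c then \<beta> (snd c (chart_inv c' x)) else 0"
  let ?V = "snd c' ` (fst c' \<inter> (topspace X - chart_inv c ` K))"
  have "C1_on (overlap c' c) (\<lambda>x. \<beta> (transition c' c x))"
    by (rule C1_on_compose[OF smooth_on_C1[OF smooth_transition[OF c' c]] \<beta>(1)]) simp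
  then have 1: "C1_on (overlap c' c) ?g"
    by (rule C1_on_cong[OF open_overlap[OF c' c]])
      (use c' in \<open>simp add: overlap_iff transition_def\<close>)
  have oV: "open ?V"
    by (intro open_chart_of_openin c' openin_diff openin_topspace closedin_chart_inv_image c K)
  have 2: "C1_on ?V ?g"
  proof (rule C1_on_cong[OF oV C1_on_const[of _ 0]])
    fix x assume "x \<in> ?V"
    then obtain q where q: "q \<in> fst c'" "q \<notin> chart_inv c ` K" "x = snd c' q"
      by (elim imageE IntE DiffE)
    have "\<beta> (snd c q) = 0" if "q \<in> fst c"
    proof (rule \<beta>(2), rule notI)
      assume "snd c q \<in> K"
      then have "q \<in> chart_inv c ` K"
        using that c by (intro image_eqI[of _ _ "snd c q"]) simp_all
      then show False
        using q by simp
    qed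
    then show "0 = ?g x"
      using q c' by simp
  qed
  have "C1_on (overlap c' c \<union> ?V) ?g"
    using C1_on_Un[OF open_overlap[OF c' c] oV 1 2] .
  moreover have "chart_image c' \<subseteq> overlap c' c \<union> ?V"
  proof
    fix x assume x: "x \<in> chart_image c'"
    show "x \<in> overlap c' c \<union> ?V"
    proof (cases "chart_inv c' x \<in> fst c")
      case True
      then show ?thesis
        using x c' by (simp add: overlap_iff)
    next
      case False
      have "chart_inv c ` K \<subseteq> fst c"
        by (rule image_subsetI, rule chart_inv_in, rule subsetD[OF K(2)])
      with False have "chart_inv c' x \<notin> chart_inv c ` K"
        by (meson subsetD)
      moreover have "chart_inv c' x \<in> topspace X"
        using subsetD[OF chart_subset[OF c'] chart_inv_in[OF x]] .
      ultimately have "x \<in> ?V"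
        by (intro image_eqI[of _ _ "chart_inv c' x"]) (simp_all add: x)
      then show ?thesis ..
    qed
  qed
  ultimately show "C1_on (chart_image c') ?g"
    by (rule Ck_on_subset)
qed

lemma frechet_derivative_transition:
  assumes c: "c \<in> A" "c' \<in> A" "x \<in> overlap c c'" and g: "C1_map g"
  shows "frechet_derivative (\<lambda>x. g (chart_inv c x)) (at x) v =
    frechet_derivative (\<lambda>x. g (chart_inv c' x)) (at (transition c c' x))
      (frechet_derivative (transition c c') (at x) v)"
proof -
  have "transition c c' x \<in> chart_image c'"
    using transition_in_overlap[OF c] overlap_subset[OF c(2)] by blast
  then have "((\<lambda>x. g (chart_inv c' x)) has_derivative
      frechet_derivative (\<lambda>x. g (chart_inv c' x)) (at (transition c c' x))) (at (transition c c' x))"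
    using g c unfolding C1_map_def by (intro C1_on_has_derivative) auto
  from has_derivative_compose[OF has_derivative_transition[OF c] this]
  have "((\<lambda>x. g (chart_inv c x)) has_derivative
     (\<lambda>v. frechet_derivative (\<lambda>x. g (chart_inv c' x)) (at (transition c c' x))
      (frechet_derivative (transition c c') (at x) v))) (at x)"
    by (rule has_derivative_transform_within_open[OF _ open_overlap[OF c(1,2)] c(3)])
      (simp add: chart_inv_transition[OF c(1,2)])
  then have "(\<lambda>v. frechet_derivative (\<lambda>x. g (chart_inv c' x)) (at (transition c c' x))
      (frechet_derivative (transition c c') (at x) v)) = frechet_derivative (\<lambda>x. g (chart_inv c x)) (at x)"
    by (rule frechet_derivative_at)
  then show ?thesis
    by metis
qed

end

text \<open>A vector density \<open>Y\<close> amounts to a form of degree \<open>n - 1\<close>, and its divergence \<open>T\<close> to the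
  exterior derivative of that form. Where \<open>T\<close> does not vanish, \<open>Y / T\<close> is an honest vector field;
  \<open>along\<close> is the derivative of functions in its direction.\<close>

locale exact_volume = manifold X A
  for X :: "'a topology" and A :: "('a, real ^ 'n::{finite,wellorder}) chart set" +
  fixes Y :: "('a, real ^ 'n::_) chart \<Rightarrow> real ^ 'n::_ \<Rightarrow> real ^ 'n::_"
    and T :: "('a, real ^ 'n::_) chart \<Rightarrow> real ^ 'n::_ \<Rightarrow> real"
  assumes C1_Y: "c \<in> A \<Longrightarrow> C1_on (chart_image c) (Y c)"
    and T_eq: "c \<in> A \<Longrightarrow> x \<in> chart_image c \<Longrightarrow> T c x = divergence (Y c) x"
    and T_nonzero: "c \<in> A \<Longrightarrow> x \<in> chart_image c \<Longrightarrow> T c x \<noteq> 0"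
    and Y_transition: "c \<in> A \<Longrightarrow> c' \<in> A \<Longrightarrow> x \<in> overlap c c' \<Longrightarrow>
      frechet_derivative (transition c c') (at x) (Y c x) =
      det (matrix (frechet_derivative (transition c c') (at x))) *\<^sub>R Y c' (transition c c' x)"
    and T_transition: "c \<in> A \<Longrightarrow> c' \<in> A \<Longrightarrow> x \<in> overlap c c' \<Longrightarrow>
      T c x = det (matrix (frechet_derivative (transition c c') (at x))) * T c' (transition c c' x)"
begin

lemma continuous_T: "c \<in> A \<Longrightarrow> continuous_on (chart_image c) (T c)"
proof -
  assume c: "c \<in> A"
  have "continuous_on (chart_image c) (divergence (Y c))"
    unfolding divergence_def[abs_def]
    by (intro continuous_on_sum continuous_on_component C1_on_continuous_derivative[OF C1_Y[OF c]])
  then show ?thesis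
    using T_eq[OF c] by (simp cong: continuous_on_cong)
qed

definition along_in :: "('a, real ^ 'n::_) chart \<Rightarrow> ('a \<Rightarrow> real) \<Rightarrow> real ^ 'n::_ \<Rightarrow> real" where
  "along_in c g x = frechet_derivative (\<lambda>x. g (chart_inv c x)) (at x) (Y c x) / T c x"

text \<open>A function on the manifold is wanted, since it gets multiplied by partition functions
  and integrated in other charts. For functions with \<open>C1_map\<close> the chosen chart does not
  affect the value, by \<open>along_in_transition\<close>.\<close>

definition along :: "('a \<Rightarrow> real) \<Rightarrow> 'a \<Rightarrow> real" where
  "along g q = (let c = SOME c. c \<in> A \<and> q \<in> fst c in along_in c g (snd c q))"

text \<open>\<open>Y\<close> and \<open>T\<close> scale by the same determinant, which is nonzero
  because \<open>T\<close> is, and cancels in the quotient.\<close>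

lemma along_in_transition:
  assumes c: "c \<in> A" "c' \<in> A" "x \<in> overlap c c'" and g: "C1_map g"
  shows "along_in c g x = along_in c' g (transition c c' x)"
proof -
  let ?y = "transition c c' x" and ?d = "det (matrix (frechet_derivative (transition c c') (at x)))"
  have "x \<in> chart_image c" "?y \<in> chart_image c'"
    using transition_in_overlap[OF c] overlap_subset c by blast+
  then have "T c x \<noteq> 0"
    using T_nonzero c by blast
  then have d: "?d \<noteq> 0"
    using T_transition[OF c] by auto
  have "linear (frechet_derivative (\<lambda>x. g (chart_inv c' x)) (at ?y))"
    using g c \<open>?y \<in> chart_image c'\<close> unfolding C1_map_def by (intro C1_on_linear) auto
  then show ?thesis
    unfolding along_in_def frechet_derivative_transition[OF c g] Y_transition[OF c] T_transition[OF c]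
    using d by (simp add: linear_scale)
qed

lemma along_chart_inv:
  assumes c: "c \<in> A" "x \<in> chart_image c" and g: "C1_map g"
  shows "along g (chart_inv c x) = along_in c g x"
proof -
  define q where "q = chart_inv c x"
  define c' where "c' = (SOME c. c \<in> A \<and> q \<in> fst c)"
  have "c' \<in> A \<and> q \<in> fst c'"
    unfolding c'_def by (rule someI[of _ c]) (use c in \<open>simp add: q_def\<close>)
  then have c': "c' \<in> A" "x \<in> overlap c c'"
    using c by (auto simp: overlap_iff q_def)
  have "along g q = along_in c' g (snd c' q)"
    unfolding along_def c'_def by (simp add: Let_def)
  also have "snd c' q = transition c c' x"
    by (simp add: transition_def q_def)
  finally show ?thesis
    using along_in_transition[OF c(1) c' g] by (simp add: q_def)
qed

lemma cont_map_along:
  assumes g: "C1_map g"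
  shows "cont_map (along g)"
  unfolding cont_map_def
proof
  fix c assume c: "c \<in> A"
  have "continuous_on (chart_image c) (along_in c g)"
    unfolding along_in_def[abs_def] using g c T_nonzero[OF c]
    by (intro continuous_on_divide continuous_on_frechet_derivative C1_on_continuous[OF C1_Y] continuous_T)
      (simp_all add: C1_map_def)
  then show "continuous_on (chart_image c) (\<lambda>x. along g (chart_inv c x))"
    using along_chart_inv[OF c _ g] by (simp cong: continuous_on_cong)
qed

text \<open>In a chart the functions add up to the constant 1, whose derivative vanishes.\<close>

lemma along_sum:
  assumes I: "finite I" "\<And>i. i \<in> I \<Longrightarrow> C1_map (g i)"
    and s: "\<And>q. q \<in> topspace X \<Longrightarrow> (\<Sum>i\<in>I. g i q) = 1" and q: "q \<in> topspace X"
  shows "(\<Sum>i\<in>I. along (g i) q) = 0"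
proof -
  obtain c where c: "c \<in> A" "q \<in> fst c"
    using q unfolding topspace_eq[symmetric] by (rule UN_E)
  define x where "x = snd c q"
  have x: "x \<in> chart_image c" "q = chart_inv c x"
    using c by (simp_all add: x_def)
  have "((\<lambda>x. \<Sum>i\<in>I. g i (chart_inv c x)) has_derivative
      (\<lambda>v. \<Sum>i\<in>I. frechet_derivative (\<lambda>x. g i (chart_inv c x)) (at x) v)) (at x)"
    using I(2) c x unfolding C1_map_def by (intro has_derivative_sum C1_on_has_derivative) auto
  moreover have "((\<lambda>x. \<Sum>i\<in>I. g i (chart_inv c x)) has_derivative (\<lambda>v. 0)) (at x)"
  proof (rule has_derivative_transform_within_open[OF has_derivative_const[of 1] open_chart_image[OF c(1)] x(1)])
    show "1 = (\<Sum>i\<in>I. g i (chart_inv c y))" if "y \<in> chart_image c" for y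
      using s[of "chart_inv c y"] subsetD[OF chart_subset[OF c(1)] chart_inv_in[OF that]] by simp
  qed
  ultimately have "(\<lambda>v. \<Sum>i\<in>I. frechet_derivative (\<lambda>x. g i (chart_inv c x)) (at x) v) = (\<lambda>v. 0)"
    by (rule has_derivative_unique)
  then have "(\<Sum>i\<in>I. frechet_derivative (\<lambda>x. g i (chart_inv c x)) (at x) (Y c x)) = 0"
    by (rule fun_cong)
  then show ?thesis
    unfolding x(2) using along_chart_inv[OF c(1) x(1) I(2)]
    by (simp add: along_in_def flip: sum_divide_distrib)
qed

text \<open>The absolute value makes the weight transform by the absolute value of the determinant,
  so the integral of a function supported in two charts is the same in both, even if the transition
  reverses orientation.\<close>

definition chart_integral :: "('a, real ^ 'n::_) chart \<Rightarrow> ('a \<Rightarrow> real) \<Rightarrow> real" where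
  "chart_integral c g = integral (chart_image c) (\<lambda>x. g (chart_inv c x) * \<bar>T c x\<bar>)"

lemma continuous_integrand:
  "c \<in> A \<Longrightarrow> cont_map g \<Longrightarrow> continuous_on (chart_image c) (\<lambda>x. g (chart_inv c x) * \<bar>T c x\<bar>)"
  unfolding cont_map_def by (intro continuous_on_mult continuous_on_rabs continuous_T) auto

lemma absolutely_integrable_integrand:
  assumes "c \<in> A" "cont_map g" "compact K" "K \<subseteq> chart_image c"
    and "\<And>x. x \<in> chart_image c \<Longrightarrow> x \<notin> K \<Longrightarrow> g (chart_inv c x) = 0"
  shows "(\<lambda>x. g (chart_inv c x) * \<bar>T c x\<bar>) absolutely_integrable_on chart_image c"
  by (rule absolutely_integrable_compact_support[OF assms(3,4) continuous_integrand[OF assms(1,2)]])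
    (use assms(5) in simp)

lemma chart_integral_sum:
  assumes "finite I" "c \<in> A" "compact K" "K \<subseteq> chart_image c" "\<And>i. i \<in> I \<Longrightarrow> cont_map (g i)"
    and "\<And>i x. i \<in> I \<Longrightarrow> x \<in> chart_image c \<Longrightarrow> x \<notin> K \<Longrightarrow> g i (chart_inv c x) = 0"
  shows "chart_integral c (\<lambda>q. \<Sum>i\<in>I. g i q) = (\<Sum>i\<in>I. chart_integral c (g i))"
  unfolding chart_integral_def sum_distrib_right
  using assms by (intro integral_sum set_lebesgue_integral_eq_integral(1)
      absolutely_integrable_integrand) blast+

lemma chart_integral_cong:
  assumes "c \<in> A" "\<And>q. q \<in> topspace X \<Longrightarrow> g q = h q"
  shows "chart_integral c g = chart_integral c h"
  unfolding chart_integral_def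
proof (rule integral_cong)
  fix x assume "x \<in> chart_image c"
  then show "g (chart_inv c x) * \<bar>T c x\<bar> = h (chart_inv c x) * \<bar>T c x\<bar>"
    using assms(2)[OF subsetD[OF chart_subset[OF assms(1)] chart_inv_in]] by simp
qed

text \<open>The support condition reduces both integrals to the two overlaps, which the transition
  map carries onto each other; there it is the change of variables formula together with
  \<open>T_transition\<close>.\<close>

lemma chart_integral_transition:
  assumes c: "c \<in> A" "c' \<in> A" and g: "cont_map g" "compact K" "K \<subseteq> chart_image c"
    and K: "\<And>x. x \<in> chart_image c \<Longrightarrow> x \<notin> K \<Longrightarrow> g (chart_inv c x) = 0"
    and supp: "\<And>q. g q \<noteq> 0 \<Longrightarrow> q \<in> fst c \<inter> fst c'"
  shows "chart_integral c g = chart_integral c' g"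
proof -
  let ?\<tau> = "transition c c'"
  have restrict: "chart_integral b g = integral (overlap b b') (\<lambda>x. g (chart_inv b x) * \<bar>T b x\<bar>)"
    if b: "b \<in> A" "b' \<in> A" and s: "\<And>q. g q \<noteq> 0 \<Longrightarrow> q \<in> fst b'" for b b'
  proof -
    have "(if x \<in> chart_image b then g (chart_inv b x) * \<bar>T b x\<bar> else 0) =
        (if x \<in> overlap b b' then g (chart_inv b x) * \<bar>T b x\<bar> else 0)" for x
      using s[of "chart_inv b x"] unfolding overlap_iff[OF b(1)] by (cases "g (chart_inv b x) = 0") simp_all
    then have "integral UNIV (\<lambda>x. if x \<in> chart_image b then g (chart_inv b x) * \<bar>T b x\<bar> else 0) =
        integral UNIV (\<lambda>x. if x \<in> overlap b b' then g (chart_inv b x) * \<bar>T b x\<bar> else 0)"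
      by (rule integral_cong)
    then show ?thesis
      unfolding chart_integral_def integral_restrict_UNIV .
  qed
  have eq: "g (chart_inv c x) * \<bar>T c x\<bar> = \<bar>det (matrix (frechet_derivative ?\<tau> (at x)))\<bar> *
      (g (chart_inv c' (?\<tau> x)) * \<bar>T c' (?\<tau> x)\<bar>)" if "x \<in> overlap c c'" for x
    unfolding chart_inv_transition[OF c that] T_transition[OF c that] by (simp add: abs_mult)
  have "(\<lambda>x. g (chart_inv c x) * \<bar>T c x\<bar>) absolutely_integrable_on overlap c c'"
  proof -
    have "(\<lambda>x. g (chart_inv c x) * \<bar>T c x\<bar>) absolutely_integrable_on chart_image c"
      by (rule absolutely_integrable_integrand[OF c(1) g K])
    then show ?thesis
      by (rule set_integrable_subset)
        (use open_overlap[OF c] overlap_subset[OF c(1)] in \<open>auto simp: borel_open\<close>)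
  qed
  then have "(\<lambda>x. \<bar>det (matrix (frechet_derivative ?\<tau> (at x)))\<bar> *
      (g (chart_inv c' (?\<tau> x)) * \<bar>T c' (?\<tau> x)\<bar>)) absolutely_integrable_on overlap c c'"
    by (rule iffD1[OF set_integrable_cong[OF refl refl eq], rotated])
  from integral_change_of_variables_real[OF open_overlap[OF c] has_derivative_transition[OF c]
      inj_on_transition[OF c] this]
  have "integral (overlap c' c) (\<lambda>x. g (chart_inv c' x) * \<bar>T c' x\<bar>) =
      integral (overlap c c') (\<lambda>x. \<bar>det (matrix (frechet_derivative ?\<tau> (at x)))\<bar> *
        (g (chart_inv c' (?\<tau> x)) * \<bar>T c' (?\<tau> x)\<bar>))"
    unfolding transition_image[OF c] .
  also have "\<dots> = integral (overlap c c') (\<lambda>x. g (chart_inv c x) * \<bar>T c x\<bar>)"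
    by (rule integral_cong) (simp only: eq)
  finally have "integral (overlap c' c) (\<lambda>x. g (chart_inv c' x) * \<bar>T c' x\<bar>) =
      integral (overlap c c') (\<lambda>x. g (chart_inv c x) * \<bar>T c x\<bar>)" .
  moreover have "chart_integral c g = integral (overlap c c') (\<lambda>x. g (chart_inv c x) * \<bar>T c x\<bar>)"
    by (rule restrict[OF c]) (use supp in blast)
  moreover have "chart_integral c' g = integral (overlap c' c) (\<lambda>x. g (chart_inv c' x) * \<bar>T c' x\<bar>)"
    by (rule restrict[OF c(2,1)]) (use supp in blast)
  ultimately show ?thesis
    by (simp only:)
qed

text \<open>The divergence theorem gives the identity with \<open>T\<close> in place of its absolute
  value. The support is taken in a ball because balls are connected: the continuous function
  \<open>T\<close> without zeros has constant sign there, and the identity may be multiplied by that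
  sign.\<close>

lemma chart_integral_divergence:
  assumes c: "c \<in> A" and r: "0 < r" "cball a r \<subseteq> chart_image c" and g: "C1_map g"
    and supp: "\<And>x. x \<in> chart_image c \<Longrightarrow> x \<notin> cball a r \<Longrightarrow> g (chart_inv c x) = 0"
  shows "chart_integral c (\<lambda>q. g q + along g q) = 0"
proof -
  let ?\<rho> = "\<lambda>x. g (chart_inv c x)" and ?K = "cball a r"
  have C1: "C1_on (chart_image c) ?\<rho>"
    using g c by (simp add: C1_map_def)
  have "connected (T c ` ?K)"
    using r by (intro connected_continuous_image continuous_on_subset[OF continuous_T[OF c]])
      (auto intro: convex_connected)
  note interval = connectedD_interval[OF this imageI imageI]
  have nz: "0 \<notin> T c ` ?K"
    using T_nonzero[OF c] r(2) by (metis imageE subsetD)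
  have "a \<in> ?K"
    using r by simp
  have sgn: "sgn (T c x) = sgn (T c a)" if "x \<in> ?K" for x
  proof (rule ccontr)
    assume "sgn (T c x) \<noteq> sgn (T c a)"
    then have "T c x \<le> 0 \<and> 0 \<le> T c a \<or> T c a \<le> 0 \<and> 0 \<le> T c x"
      by (auto simp: sgn_if split: if_splits)
    then show False
      using interval[OF that \<open>a \<in> ?K\<close>, of 0] interval[OF \<open>a \<in> ?K\<close> that, of 0] nz by blast
  qed
  have "((\<lambda>x. frechet_derivative ?\<rho> (at x) (Y c x) + ?\<rho> x * divergence (Y c) x) has_integral 0) (chart_image c)"
    using has_integral_divergence[OF open_chart_image[OF c] C1_Y[OF c] C1 compact_cball r(2) supp] .
  then have "((\<lambda>x. sgn (T c a) * (frechet_derivative ?\<rho> (at x) (Y c x) + ?\<rho> x * divergence (Y c) x))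
      has_integral (sgn (T c a) * 0)) (chart_image c)"
    by (rule has_integral_mult_right)
  note int = this
  have eq: "sgn (T c a) * (frechet_derivative ?\<rho> (at x) (Y c x) + ?\<rho> x * divergence (Y c) x) =
      (?\<rho> x + along g (chart_inv c x)) * \<bar>T c x\<bar>" if x: "x \<in> chart_image c" for x
  proof (cases "x \<in> ?K")
    case True
    have "frechet_derivative ?\<rho> (at x) (Y c x) + ?\<rho> x * divergence (Y c) x =
        (?\<rho> x + along g (chart_inv c x)) * T c x"
      using T_nonzero[OF c x]
      by (simp add: along_chart_inv[OF c x g] along_in_def T_eq[OF c x, symmetric] field_simps)
    then show ?thesis
      using sgn[OF True] by (simp add: abs_sgn)
  next
    case False
    have "(?\<rho> has_derivative (\<lambda>v. 0)) (at x)"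
      by (rule has_derivative_transform_within_open[OF has_derivative_const[of 0],
            where s = "chart_image c - ?K"])
        (use False x open_chart_image[OF c] supp in \<open>auto intro: open_Diff\<close>)
    then have "frechet_derivative ?\<rho> (at x) = (\<lambda>v. 0)"
      by (rule frechet_derivative_at[symmetric])
    then show ?thesis
      using supp[OF x False] by (simp add: along_chart_inv[OF c x g] along_in_def)
  qed
  show ?thesis
    unfolding chart_integral_def by (rule integral_unique) (use has_integral_eq[OF eq int] in simp)
qed

text \<open>Let J_p denote integration in the chart of p. Then J_p(\<rho>_p) = - J_p(along
  \<rho>_p). Inserting the sum of all \<rho>_s, which is 1, and moving each product \<rho>_s along
  \<rho>_p from the chart of p to that of s, the sum of all J_p(\<rho>_p) becomes minus the sum over
  s of J_s(\<rho>_s \<Sigma>_p along \<rho>_p). The inner sum is the derivative of the constant 1.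
  So the nonnegative numbers J_p(\<rho>_p) add up to 0, although one of them is positive.\<close>

lemma not_compact:
  assumes "compact_space X" "topspace X \<noteq> {}"
  shows False
proof -
  have "\<exists>c r. c \<in> A \<and> p \<in> fst c \<and> 0 < r \<and> cball (snd c p) r \<subseteq> chart_image c" if "p \<in> topspace X" for p
  proof -
    obtain c where c: "c \<in> A" "p \<in> fst c"
      using \<open>p \<in> topspace X\<close> unfolding topspace_eq[symmetric] by (rule UN_E)
    then obtain r where "0 < r" "cball (snd c p) r \<subseteq> chart_image c"
      using open_contains_cball[of "chart_image c"] open_chart_image chart_in_image by metis
    then show ?thesis
      using c by blast
  qed
  then obtain c r where c: "\<And>p. p \<in> topspace X \<Longrightarrow> c p \<in> A" "\<And>p. p \<in> topspace X \<Longrightarrow> p \<in> fst (c p)"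
    and r: "\<And>p. p \<in> topspace X \<Longrightarrow> 0 < r p"
      "\<And>p. p \<in> topspace X \<Longrightarrow> cball (snd (c p) p) (r p) \<subseteq> chart_image (c p)"
    by metis
  \<comment> \<open>The closed balls \<open>B p\<close> contain the supports and are compact in
    their charts; the open sets \<open>V p\<close> of the open balls form the cover.\<close>
  define B where "B = (\<lambda>p. cball (snd (c p) p) (r p))"
  define V where "V = (\<lambda>p. {q \<in> fst (c p). snd (c p) q \<in> ball (snd (c p) p) (r p)})"
  have V: "openin X (V p)" "p \<in> V p" if "p \<in> topspace X" for p
    using c[OF that] r[OF that] openin_chart_preimage[OF c(1)[OF that] open_ball]
    unfolding V_def by simp_all
  have "\<exists>\<F>. finite \<F> \<and> \<F> \<subseteq> V ` topspace X \<and> topspace X \<subseteq> \<Union>\<F>"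
    using assms(1) V unfolding compact_space_alt by (elim allE[of _ "V ` topspace X"]) auto
  then obtain F where F: "finite F" "F \<subseteq> topspace X" "topspace X \<subseteq> \<Union>(V ` F)"
    using finite_subset_image by metis
  note cF = c[OF subsetD[OF F(2)]] and rF = r[OF subsetD[OF F(2)]]
  define \<psi> where "\<psi> = (\<lambda>p q. if q \<in> fst (c p) then bump (snd (c p) p) (r p) (snd (c p) q) else 0)"
  have C1\<psi>: "C1_map (\<psi> p)" if "p \<in> F" for p
    unfolding \<psi>_def
  proof (rule C1_map_chart_function[OF cF(1)[OF that] compact_cball rF(2)[OF that] C1_on_bump])
    show "bump (snd (c p) p) (r p) x = 0" if "x \<notin> cball (snd (c p) p) (r p)" for x
      using that rF(1)[OF \<open>p \<in> F\<close>] by (intro bump_outside) auto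
  qed
  have \<psi>0: "0 \<le> \<psi> p q" for p q
    by (simp add: \<psi>_def bump_nonneg)
  have \<psi>V: "0 < \<psi> p q" if "q \<in> V p" for p q
    using that by (simp add: \<psi>_def V_def bump_pos)
  define \<Psi> where "\<Psi> = (\<lambda>q. \<Sum>p\<in>F. \<psi> p q)"
  have \<Psi>: "0 < \<Psi> q" if "q \<in> topspace X" for q
  proof -
    obtain p where "p \<in> F" "q \<in> V p"
      using F(3) \<open>q \<in> topspace X\<close> by blast
    then show ?thesis
      unfolding \<Psi>_def by (intro sum_pos2[of F p]) (simp_all add: F \<psi>0 \<psi>V)
  qed
  define \<rho> where "\<rho> = (\<lambda>p q. \<psi> p q / \<Psi> q)"
  have C1\<rho>: "C1_map (\<rho> p)" if "p \<in> F" for p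
    unfolding C1_map_def
  proof
    fix b assume b: "b \<in> A"
    have "C1_on (chart_image b) (\<lambda>x. \<Psi> (chart_inv b x))"
      unfolding \<Psi>_def using C1\<psi> b by (intro C1_on_sum[OF F(1)]) (simp add: C1_map_def)
    moreover have "\<Psi> (chart_inv b x) \<noteq> 0" if "x \<in> chart_image b" for x
      using \<Psi>[OF subsetD[OF chart_subset[OF b] chart_inv_in[OF that]]] by simp
    moreover have "C1_on (chart_image b) (\<lambda>x. \<psi> p (chart_inv b x))"
      using C1\<psi>[OF that] b by (simp add: C1_map_def)
    ultimately show "C1_on (chart_image b) (\<lambda>x. \<rho> p (chart_inv b x))"
      unfolding \<rho>_def by (intro C1_on_divide)
  qed
  have \<rho>1: "(\<Sum>p\<in>F. \<rho> p q) = 1" if "q \<in> topspace X" for q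
    using \<Psi>[OF that] unfolding \<rho>_def by (simp add: \<Psi>_def flip: sum_divide_distrib)
  have \<rho>supp: "\<rho> p q = 0" if "p \<in> F" "q \<notin> fst (c p) \<or> snd (c p) q \<notin> B p" for p q
    using that rF(1)[OF that(1)] by (auto simp: \<rho>_def \<psi>_def B_def intro!: bump_outside)
  have \<rho>chart: "\<rho> p (chart_inv (c p) x) = 0" if "p \<in> F" "x \<in> chart_image (c p)" "x \<notin> B p" for p x
    using that by (intro \<rho>supp) auto
  note cont\<rho> = C1_map_cont[OF C1\<rho>] and contL = cont_map_along[OF C1\<rho>]
  have compB: "compact (B p)" for p
    by (simp add: B_def)
  have BU: "p \<in> F \<Longrightarrow> B p \<subseteq> chart_image (c p)" for p
    unfolding B_def by (rule rF(2))
  let ?J = "\<lambda>p. chart_integral (c p)"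
  have cont_mult: "cont_map (\<lambda>q. f q * g q)" if "cont_map f" "cont_map g" for f g
    using that unfolding cont_map_def by (auto intro: continuous_on_mult)
  \<comment> \<open>The support is closed in the whole manifold, so the derivative also vanishes at
    points outside the chart of \<open>p\<close>. Products with \<open>along (\<rho> p)\<close> are
    therefore supported in that chart.\<close>
  have along0: "along (\<rho> p) q = 0" if p: "p \<in> F" and q: "q \<in> topspace X" "q \<notin> fst (c p) \<or> snd (c p) q \<notin> B p" for p q
  proof -
    obtain b where b: "b \<in> A" "q \<in> fst b"
      using q(1) unfolding topspace_eq[symmetric] by (rule UN_E)
    let ?W = "snd b ` (fst b \<inter> (topspace X - chart_inv (c p) ` B p))"
    have W: "open ?W"
      by (intro open_chart_of_openin b openin_diff openin_topspace closedin_chart_inv_image cF p compB BU)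
    have "q \<notin> chart_inv (c p) ` B p"
    proof
      assume "q \<in> chart_inv (c p) ` B p"
      then obtain x where "x \<in> B p" "q = chart_inv (c p) x"
        by blast
      moreover have "x \<in> chart_image (c p)"
        using \<open>x \<in> B p\<close> BU[OF p] by blast
      ultimately show False
        using q(2) by simp
    qed
    then have qW: "snd b q \<in> ?W"
      using b q(1) by (intro imageI) simp
    have "((\<lambda>x. \<rho> p (chart_inv b x)) has_derivative (\<lambda>v. 0)) (at (snd b q))"
    proof (rule has_derivative_transform_within_open[OF has_derivative_const[of 0] W qW])
      fix x assume "x \<in> ?W"
      then obtain q' where q': "q' \<in> fst b" "q' \<notin> chart_inv (c p) ` B p" "x = snd b q'"
        by (elim imageE IntE DiffE)
      have "q' \<notin> fst (c p) \<or> snd (c p) q' \<notin> B p"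
      proof (rule ccontr, simp)
        assume *: "q' \<in> fst (c p) \<and> snd (c p) q' \<in> B p"
        then have "q' = chart_inv (c p) (snd (c p) q')"
          using cF(1)[OF p] by simp
        then show False
          using q'(2) * by blast
      qed
      then show "0 = \<rho> p (chart_inv b x)"
        using q' b \<rho>supp[OF p] by simp
    qed
    then have "frechet_derivative (\<lambda>x. \<rho> p (chart_inv b x)) (at (snd b q)) = (\<lambda>v. 0)"
      by (rule frechet_derivative_at[symmetric])
    then have "along_in b (\<rho> p) (snd b q) = 0"
      by (simp add: along_in_def)
    then show ?thesis
      using along_chart_inv[OF b(1) chart_in_image[OF b(2)] C1\<rho>[OF p]] b by simp
  qed
  have along0chart: "along (\<rho> p) (chart_inv (c p) x) = 0" if "p \<in> F" "x \<in> chart_image (c p)" "x \<notin> B p" for p x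
    using that subsetD[OF chart_subset[OF cF(1)[OF that(1)]] chart_inv_in[OF that(2)]]
    by (intro along0) auto
  have J1: "?J p (\<rho> p) = - ?J p (along (\<rho> p))" if p: "p \<in> F" for p
  proof -
    \<comment> \<open>Additivity for two functions, as a sum indexed by the two truth
      values.\<close>
    have "?J p (\<lambda>q. \<Sum>i\<in>UNIV. (if i then \<rho> p else along (\<rho> p)) q) =
        (\<Sum>i\<in>UNIV. ?J p (if i then \<rho> p else along (\<rho> p)))"
      by (rule chart_integral_sum[OF _ cF(1)[OF p] compB BU[OF p]])
        (use cont\<rho>[OF p] contL[OF p] \<rho>chart[OF p] along0chart[OF p] in \<open>auto split: if_splits\<close>)
    moreover have "?J p (\<lambda>q. \<rho> p q + along (\<rho> p) q) = 0"
      by (rule chart_integral_divergence[OF cF(1)[OF p] rF[OF p] C1\<rho>[OF p]])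
        (use \<rho>chart[OF p] in \<open>simp add: B_def\<close>)
    ultimately show ?thesis
      by (simp add: UNIV_bool add.commute)
  qed
  have J2: "?J p (along (\<rho> p)) = (\<Sum>s\<in>F. ?J s (\<lambda>q. \<rho> s q * along (\<rho> p) q))" if p: "p \<in> F" for p
  proof -
    have "?J p (along (\<rho> p)) = ?J p (\<lambda>q. \<Sum>s\<in>F. \<rho> s q * along (\<rho> p) q)"
      by (rule chart_integral_cong[OF cF(1)[OF p]]) (simp add: \<rho>1 flip: sum_distrib_right)
    also have "\<dots> = (\<Sum>s\<in>F. ?J p (\<lambda>q. \<rho> s q * along (\<rho> p) q))"
      by (rule chart_integral_sum[OF F(1) cF(1)[OF p] compB BU[OF p]])
        (simp_all add: cont_mult cont\<rho> contL p along0chart[OF p])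
    also have "\<dots> = (\<Sum>s\<in>F. ?J s (\<lambda>q. \<rho> s q * along (\<rho> p) q))"
    proof (rule sum.cong[OF refl])
      fix s assume s: "s \<in> F"
      \<comment> \<open>Outside \<open>topspace X\<close> the value of \<open>along\<close> is
        unspecified, whereas \<open>chart_integral_transition\<close> asks for the support condition
        at every point of the type; hence the cut-off.\<close>
      define h where "h = (\<lambda>q. if q \<in> topspace X then \<rho> s q * along (\<rho> p) q else 0)"
      have eq: "?J t (\<lambda>q. \<rho> s q * along (\<rho> p) q) = ?J t h" if "t \<in> F" for t
        by (rule chart_integral_cong[OF cF(1)[OF that]]) (simp add: h_def)
      have conth: "cont_map h"
        unfolding cont_map_def
      proof
        fix b assume b: "b \<in> A"
        have "continuous_on (chart_image b) (\<lambda>x. \<rho> s (chart_inv b x) * along (\<rho> p) (chart_inv b x))"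
          using cont_mult[OF cont\<rho>[OF s] contL[OF p]] b by (simp add: cont_map_def)
        moreover have "h (chart_inv b x) = \<rho> s (chart_inv b x) * along (\<rho> p) (chart_inv b x)"
          if "x \<in> chart_image b" for x
          using subsetD[OF chart_subset[OF b] chart_inv_in[OF that]] by (simp add: h_def)
        ultimately show "continuous_on (chart_image b) (\<lambda>x. h (chart_inv b x))"
          by (simp cong: continuous_on_cong)
      qed
      have "?J p h = ?J s h"
      proof (rule chart_integral_transition[OF cF(1)[OF p] cF(1)[OF s] conth compB BU[OF p]])
        show "h (chart_inv (c p) x) = 0" if "x \<in> chart_image (c p)" "x \<notin> B p" for x
          using along0chart[OF p that] by (simp add: h_def)
        fix q assume "h q \<noteq> 0"
        then have "q \<in> topspace X" "\<rho> s q \<noteq> 0" "along (\<rho> p) q \<noteq> 0"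
          by (auto simp: h_def split: if_splits)
        then show "q \<in> fst (c p) \<inter> fst (c s)"
          using along0[OF p] \<rho>supp[OF s] by blast
      qed
      then show "?J p (\<lambda>q. \<rho> s q * along (\<rho> p) q) = ?J s (\<lambda>q. \<rho> s q * along (\<rho> p) q)"
        using eq s p by simp
    qed
    finally show ?thesis .
  qed
  have "(\<Sum>p\<in>F. ?J p (\<rho> p)) = - (\<Sum>p\<in>F. \<Sum>s\<in>F. ?J s (\<lambda>q. \<rho> s q * along (\<rho> p) q))"
    by (simp add: J1 J2 sum_negf)
  also have "(\<Sum>p\<in>F. \<Sum>s\<in>F. ?J s (\<lambda>q. \<rho> s q * along (\<rho> p) q)) =
      (\<Sum>s\<in>F. \<Sum>p\<in>F. ?J s (\<lambda>q. \<rho> s q * along (\<rho> p) q))"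
    by (rule sum.swap)
  \<comment> \<open>After the swap, the inner sum over \<open>p\<close> is taken inside the chart of
    \<open>s\<close> with the fixed compact support of \<rho>_s, so it can be pulled under the
    integral and \<open>along_sum\<close> applies.\<close>
  also have "\<dots> = (\<Sum>s\<in>F. 0)"
  proof (rule sum.cong[OF refl])
    fix s assume s: "s \<in> F"
    have "(\<Sum>p\<in>F. ?J s (\<lambda>q. \<rho> s q * along (\<rho> p) q)) = ?J s (\<lambda>q. \<Sum>p\<in>F. \<rho> s q * along (\<rho> p) q)"
      by (rule chart_integral_sum[OF F(1) cF(1)[OF s] compB BU[OF s], symmetric])
        (simp_all add: cont_mult cont\<rho> contL s \<rho>chart[OF s])
    also have "\<dots> = ?J s (\<lambda>q. 0)"
      by (rule chart_integral_cong[OF cF(1)[OF s]])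
        (simp add: along_sum[OF F(1) C1\<rho> \<rho>1] flip: sum_distrib_left)
    also have "\<dots> = 0"
      by (simp add: chart_integral_def)
    finally show "(\<Sum>p\<in>F. ?J s (\<lambda>q. \<rho> s q * along (\<rho> p) q)) = 0" .
  qed
  finally have sum0: "(\<Sum>p\<in>F. ?J p (\<rho> p)) = 0"
    by simp
  have nonneg: "0 \<le> \<rho> p q" if "q \<in> topspace X" for p q
    unfolding \<rho>_def using \<psi>0 \<Psi>[OF that] by simp
  have Jnonneg: "0 \<le> ?J p (\<rho> p)" if p: "p \<in> F" for p
    unfolding chart_integral_def
  proof (rule integral_nonneg)
    show "(\<lambda>x. \<rho> p (chart_inv (c p) x) * \<bar>T (c p) x\<bar>) integrable_on chart_image (c p)"
      by (intro set_lebesgue_integral_eq_integral(1)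
          absolutely_integrable_integrand[OF cF(1)[OF p] cont\<rho>[OF p] compB BU[OF p] \<rho>chart[OF p]])
    show "0 \<le> \<rho> p (chart_inv (c p) x) * \<bar>T (c p) x\<bar>" if "x \<in> chart_image (c p)" for x
      using nonneg[OF subsetD[OF chart_subset[OF cF(1)[OF p]] chart_inv_in[OF that]]] by simp
  qed
  obtain q0 where q0: "q0 \<in> topspace X"
    using assms(2) by blast
  then obtain p where p: "p \<in> F" "q0 \<in> V p"
    using F(3) by blast
  \<comment> \<open>A vanishing sum of nonnegative terms. The index \<open>p\<close> was chosen such
    that \<rho>_p is positive at \<open>q0\<close>.\<close>
  have "?J p (\<rho> p) = 0"
    using sum0 sum_nonneg_eq_0_iff[of F "\<lambda>p. ?J p (\<rho> p)"] F(1) Jnonneg p(1) by blast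
  let ?h = "\<lambda>x. \<rho> p (chart_inv (c p) x) * \<bar>T (c p) x\<bar>" and ?x = "snd (c p) q0"
  have x0: "?x \<in> ball (snd (c p) p) (r p)" "q0 \<in> fst (c p)"
    using p(2) by (simp_all add: V_def)
  have hpos: "0 \<le> ?h x" if "x \<in> chart_image (c p)" for x
    using nonneg[OF subsetD[OF chart_subset[OF cF(1)[OF p(1)]] chart_inv_in[OF that]]] by simp
  have "?h integrable_on chart_image (c p)"
    by (intro set_lebesgue_integral_eq_integral(1)
        absolutely_integrable_integrand[OF cF(1)[OF p(1)] cont\<rho>[OF p(1)] compB BU[OF p(1)] \<rho>chart[OF p(1)]])
  then have int: "(?h has_integral 0) (chart_image (c p))"
    using \<open>?J p (\<rho> p) = 0\<close> unfolding chart_integral_def by (metis integrable_integral)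
  have cont: "continuous_on (chart_image (c p)) ?h"
    by (rule continuous_integrand[OF cF(1)[OF p(1)] cont\<rho>[OF p(1)]])
  obtain l u where lu: "?x \<in> box l u" "cbox l u \<subseteq> chart_image (c p)"
    using open_contains_cbox[OF open_chart_image[OF cF(1)[OF p(1)]] chart_in_image[OF x0(2)]] by metis
  \<comment> \<open>The integrand is continuous and nonnegative with integral 0, also on a box
    around the point, so it vanishes there; but \<open>T\<close> is nonzero and \<rho>_p is
    positive.\<close>
  have "?h ?x = 0"
  proof (rule has_integral_0_cbox_imp_0[of l u ?h ?x])
    show "continuous_on (cbox l u) ?h"
      using cont lu(2) by (rule continuous_on_subset)
    show "0 \<le> ?h x" if "x \<in> box l u" for x
      using hpos that lu(2) box_subset_cbox[of l u] by blast
    have intc: "?h integrable_on cbox l u"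
      by (rule integrable_continuous[OF continuous_on_subset[OF cont lu(2)]])
    then have "integral (cbox l u) ?h \<le> integral (chart_image (c p)) ?h"
      using int hpos by (intro integral_subset_le lu(2)) auto
    moreover have "0 \<le> integral (cbox l u) ?h"
      by (rule integral_nonneg[OF intc]) (use hpos lu(2) in blast)
    ultimately have "integral (cbox l u) ?h = 0"
      using integral_unique[OF int] by simp
    then show "(?h has_integral 0) (cbox l u)"
      using integrable_integral[OF intc] by simp
    show "box l u \<noteq> {}" "?x \<in> cbox l u"
      using lu(1) box_subset_cbox by auto
  qed
  then have "\<rho> p q0 = 0"
    using T_nonzero[OF cF(1)[OF p(1)] chart_in_image[OF x0(2)]] x0(2) cF(1)[OF p(1)] by simp
  then show False
    using \<psi>V[OF p(2)] \<Psi>[OF q0] by (simp add: \<rho>_def)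
qed

end

section \<open>Alternation of multilinear functions\<close>

text \<open>The slots in \<open>S\<close> are expanded one after the other. The remaining entries
  \<open>v\<close> are arbitrary in the induction, so the new slot can be filled before the
  induction hypothesis is used.\<close>

lemma multilinear_expand:
  fixes F :: "('i \<Rightarrow> 'v::real_vector) \<Rightarrow> real"
  assumes ml: "\<And>v i. linear (\<lambda>u. F (v(i := u)))" and K: "finite K" and S: "finite S"
  shows "F (\<lambda>i. if i \<in> S then \<Sum>k\<in>K. c i k *\<^sub>R e k else v i) =
    (\<Sum>f\<in>S \<rightarrow>\<^sub>E K. (\<Prod>i\<in>S. c i (f i)) * F (\<lambda>i. if i \<in> S then e (f i) else v i))"
  using S
proof (induction S arbitrary: v rule: finite_induct)
  case (insert j S)
  let ?G = "\<lambda>f. \<lambda>i. if i \<in> S then e (f i) else v i"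
  have "F (\<lambda>i. if i \<in> insert j S then \<Sum>k\<in>K. c i k *\<^sub>R e k else v i) =
      F (\<lambda>i. if i \<in> S then \<Sum>k\<in>K. c i k *\<^sub>R e k else (v(j := \<Sum>k\<in>K. c j k *\<^sub>R e k)) i)"
    using insert.hyps by (intro arg_cong[where f = F]) auto
  also have "\<dots> = (\<Sum>f\<in>S \<rightarrow>\<^sub>E K. (\<Prod>i\<in>S. c i (f i)) *
      F (\<lambda>i. if i \<in> S then e (f i) else (v(j := \<Sum>k\<in>K. c j k *\<^sub>R e k)) i))"
    by (rule insert.IH)
  also have "\<dots> = (\<Sum>f\<in>S \<rightarrow>\<^sub>E K. \<Sum>y\<in>K. (\<Prod>i\<in>S. c i (f i)) * (c j y * F ((?G f)(j := e y))))"
  proof (rule sum.cong[OF refl])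
    fix f
    have "(\<lambda>i. if i \<in> S then e (f i) else (v(j := \<Sum>k\<in>K. c j k *\<^sub>R e k)) i) = (?G f)(j := \<Sum>k\<in>K. c j k *\<^sub>R e k)"
      using insert.hyps by auto
    then show "(\<Prod>i\<in>S. c i (f i)) * F (\<lambda>i. if i \<in> S then e (f i) else (v(j := \<Sum>k\<in>K. c j k *\<^sub>R e k)) i) =
        (\<Sum>y\<in>K. (\<Prod>i\<in>S. c i (f i)) * (c j y * F ((?G f)(j := e y))))"
      using linear_sum[OF ml, of "?G f" j "\<lambda>k. c j k *\<^sub>R e k" K]
      by (simp add: linear_scale[OF ml] sum_distrib_left)
  qed
  also have "\<dots> = (\<Sum>y\<in>K. \<Sum>f\<in>S \<rightarrow>\<^sub>E K. (\<Prod>i\<in>S. c i (f i)) * (c j y * F ((?G f)(j := e y))))"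
    by (rule sum.swap)
  also have "\<dots> = (\<Sum>(y, f)\<in>K \<times> (S \<rightarrow>\<^sub>E K). (\<Prod>i\<in>S. c i (f i)) * (c j y * F ((?G f)(j := e y))))"
    by (simp add: sum.cartesian_product)
  also have "\<dots> = (\<Sum>(y, f)\<in>K \<times> (S \<rightarrow>\<^sub>E K). (\<Prod>i\<in>insert j S. c i ((f(j := y)) i)) *
      F (\<lambda>i. if i \<in> insert j S then e ((f(j := y)) i) else v i))"
  proof (rule sum.cong[OF refl], safe)
    fix y f
    have "(\<Prod>i\<in>insert j S. c i ((f(j := y)) i)) = c j y * (\<Prod>i\<in>S. c i (f i))"
      using insert.hyps by (simp add: prod.insert) (intro disjI2 prod.cong, auto)
    moreover have "(?G f)(j := e y) = (\<lambda>i. if i \<in> insert j S then e ((f(j := y)) i) else v i)"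
      by auto
    ultimately show "(\<Prod>i\<in>S. c i (f i)) * (c j y * F ((?G f)(j := e y))) =
        (\<Prod>i\<in>insert j S. c i ((f(j := y)) i)) * F (\<lambda>i. if i \<in> insert j S then e ((f(j := y)) i) else v i)"
      by (simp only: mult_ac)
  qed
  also have "\<dots> = (\<Sum>f\<in>insert j S \<rightarrow>\<^sub>E K. (\<Prod>i\<in>insert j S. c i (f i)) *
      F (\<lambda>i. if i \<in> insert j S then e (f i) else v i))"
    unfolding PiE_insert_eq using inj_combinator[OF insert.hyps(2), of "\<lambda>_. K"]
    by (subst sum.reindex) (simp_all add: case_prod_unfold)
  finally show ?case .
qed simp

text \<open>The slots are indexed by the coordinates themselves, so these are the permutations that
  occur in \<open>det\<close>. For a tensor product of alternating forms of degrees k, l, ... with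
  total degree n, the value is k! l! ... times that of their wedge product on the standard
  basis.\<close>

definition alternation :: "(('n::finite \<Rightarrow> real ^ 'n) \<Rightarrow> real) \<Rightarrow> real" where
  "alternation F = (\<Sum>p | p permutes UNIV. of_int (sign p) * F (\<lambda>i. axis (p i) 1))"

text \<open>As in the proof that determinants are multiplicative: expand each image in the basis and
  exchange the sums. An index map \<open>f\<close> that is not injective yields a determinant with
  two equal rows; a permutation yields the sign times the determinant of \<open>L\<close>.\<close>

lemma alternation_linear_image:
  fixes F :: "('n::finite \<Rightarrow> real ^ 'n) \<Rightarrow> real"
  assumes ml: "\<And>v i. linear (\<lambda>u. F (v(i := u)))" and L: "linear L"
  shows "alternation (\<lambda>v. F (\<lambda>i. L (v i))) = det (matrix L) * alternation F"
proof -
  let ?P = "{p. p permutes (UNIV :: 'n set)}"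
  let ?M = "matrix L"
  have col: "L (axis j 1) = (\<Sum>k\<in>UNIV. ?M $ k $ j *\<^sub>R axis k 1)" for j
    using basis_expansion[of "L (axis j 1)"] by (simp add: scalar_mult_eq_scaleR matrix_def)
  have "alternation (\<lambda>v. F (\<lambda>i. L (v i))) =
      (\<Sum>p\<in>?P. of_int (sign p) * (\<Sum>f\<in>UNIV. (\<Prod>i\<in>UNIV. ?M $ f i $ p i) * F (\<lambda>i. axis (f i) 1)))"
    unfolding alternation_def col
    using multilinear_expand[OF ml, of UNIV UNIV "\<lambda>i k. ?M $ k $ p i" "\<lambda>k. axis k 1" undefined for p]
    by simp
  also have "\<dots> = (\<Sum>f\<in>UNIV. \<Sum>p\<in>?P. of_int (sign p) * ((\<Prod>i\<in>UNIV. ?M $ f i $ p i) * F (\<lambda>i. axis (f i) 1)))"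
    unfolding sum_distrib_left by (rule sum.swap)
  also have "\<dots> = (\<Sum>f\<in>UNIV. det (\<chi> i. ?M $ f i) * F (\<lambda>i. axis (f i) 1))"
    by (simp add: det_def sum_distrib_right mult.assoc)
  also have "\<dots> = (\<Sum>f\<in>?P. det (\<chi> i. ?M $ f i) * F (\<lambda>i. axis (f i) 1))"
  proof (rule sum.mono_neutral_right, simp, simp, rule ballI)
    fix f :: "'n \<Rightarrow> 'n" assume "f \<in> UNIV - ?P"
    then have "\<not> bij f"
      by (auto dest: bij_imp_permutes)
    then have "\<not> inj f"
      by (auto simp: bij_def dest: finite_UNIV_inj_surj[OF finite])
    then obtain i j where "i \<noteq> j" "f i = f j"
      by (auto simp: inj_def)
    then have "det (\<chi> i. ?M $ f i) = 0"
      by (intro det_identical_rows[of i j]) (auto simp: row_def vec_eq_iff)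
    then show "det (\<chi> i. ?M $ f i) * F (\<lambda>i. axis (f i) 1) = 0"
      by simp
  qed
  also have "\<dots> = (\<Sum>f\<in>?P. det ?M * (of_int (sign f) * F (\<lambda>i. axis (f i) 1)))"
    by (rule sum.cong) (simp_all add: det_permute_rows)
  finally show ?thesis
    by (simp add: alternation_def sum_distrib_left)
qed

lemma alternation_swap:
  assumes "i \<noteq> j"
  shows "alternation (\<lambda>v. F (v \<circ> Transposition.transpose i j)) = - alternation F"
proof -
  have t: "Transposition.transpose i j permutes UNIV"
    by (rule permutes_swap_id) auto
  have "of_int (sign (p \<circ> Transposition.transpose i j)) = - (of_int (sign p) :: real)"
    if "p permutes UNIV" for p
  proof -
    have "permutation p"
      using that finite permutation_permutes by blast
    then show ?thesis
      using assms by (simp add: sign_compose permutation_swap_id sign_swap_id)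
  qed
  then have "alternation F = (\<Sum>p | p permutes UNIV. - (of_int (sign p) *
      F (\<lambda>k. axis ((p \<circ> Transposition.transpose i j) k) 1)))"
    unfolding alternation_def by (subst sum_permutations_compose_right[OF t]) (intro sum.cong, auto)
  then show ?thesis
    by (simp add: alternation_def sum_negf comp_def)
qed

lemma alternation_add: "alternation (\<lambda>v. F v + G v) = alternation F + alternation G"
  by (simp add: alternation_def distrib_left sum.distrib)

lemma alternation_diff: "alternation (\<lambda>v. F v - G v) = alternation F - alternation G"
  by (simp add: alternation_def right_diff_distrib sum_subtractf)

lemma alternation_minus: "alternation (\<lambda>v. - F v) = - alternation F"
  by (simp add: alternation_def sum_negf)

lemma alternation_zero: "alternation (\<lambda>v. 0) = 0"
  by (simp add: alternation_def)

section \<open>Products of top degree in dimension seven\<close>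

lemma transpose7 [simp]:
  fixes a b i :: 7
  shows "Transposition.transpose a b i = (if i = a then b else if i = b then a else i)"
  by (simp add: Transposition.transpose_def)

text \<open>A tensor product, with slots in the order 1, ..., 7. If the factors are alternating, its
  \<open>alternation\<close> is 2! 2! 3! = 24 times the coefficient of their wedge product. The
  first factor need not be skew, which leaves room for derivatives and for products of two linear
  functionals.\<close>

definition form7 :: "('v \<Rightarrow> 'v \<Rightarrow> real) \<Rightarrow> ('v \<Rightarrow> 'v \<Rightarrow> real) \<Rightarrow> ('v \<Rightarrow> 'v \<Rightarrow> 'v \<Rightarrow> real) \<Rightarrow> (7 \<Rightarrow> 'v) \<Rightarrow> real" where
  "form7 b b' f v = b (v 1) (v 2) * b' (v 3) (v 4) * f (v 5) (v 6) (v 7)"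

text \<open>Exchanging slots 1 and 2 changes the sign, so only the skew part of \<open>A\<close>
  counts. When \<open>A\<close> is the derivative of a 1-form, the skew difference is its exterior
  derivative; this is the origin of the factor 1/2.\<close>

lemma alternation_first:
  fixes A :: "real ^ 7 \<Rightarrow> real ^ 7 \<Rightarrow> real"
  shows "alternation (form7 A b f) = 1/2 * alternation (form7 (\<lambda>u v. A u v - A v u) b f)"
proof -
  have "alternation (form7 (\<lambda>u v. A v u) b f) = - alternation (form7 A b f)"
    using alternation_swap[of "1::7" 2 "form7 A b f"] by (simp add: form7_def[abs_def])
  moreover have "alternation (form7 (\<lambda>u v. A u v - A v u) b f) =
      alternation (form7 A b f) - alternation (form7 (\<lambda>u v. A v u) b f)"
    unfolding alternation_diff[symmetric] by (simp add: form7_def[abs_def] left_diff_distrib)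
  ultimately show ?thesis
    by simp
qed

text \<open>Here \<open>A u\<close> stands for the derivative of a 2-form in direction
  \<open>u\<close>, and \<open>cyc\<close> says that the 2-form is closed. Swaps of slots show that
  the three terms of \<open>cyc\<close> contribute equally, so three times the value is 0.\<close>

lemma alternation_second:
  fixes A :: "real ^ 7 \<Rightarrow> real ^ 7 \<Rightarrow> real ^ 7 \<Rightarrow> real"
  assumes skew: "\<And>u v w. A u v w = - A u w v"
    and cyc: "\<And>u v w. A u v w - A v u w + A w u v = 0"
  shows "alternation (\<lambda>v. a (v 2) * A (v 1) (v 3) (v 4) * f (v 5) (v 6) (v 7)) = 0"
proof -
  let ?S = "\<lambda>i j k. alternation (\<lambda>v. a (v (2::7)) * A (v i) (v j) (v k) * f (v 5) (v 6) (v 7))"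
  have "?S 3 1 4 = - ?S 1 3 4"
    using alternation_swap[of "1::7" 3 "\<lambda>v. a (v 2) * A (v 1) (v 3) (v 4) * f (v 5) (v 6) (v 7)"] by simp
  moreover have "?S 4 1 3 = ?S 1 3 4"
    using alternation_swap[of "1::7" 4 "\<lambda>v. a (v 2) * A (v 1) (v 3) (v 4) * f (v 5) (v 6) (v 7)"]
    by (simp add: skew[of "v 4" "v 3" "v 1" for v] alternation_minus)
  moreover have "alternation (\<lambda>v. a (v 2) * (A (v 1) (v 3) (v 4) - A (v 3) (v 1) (v 4) + A (v 4) (v 1) (v 3)) *
      f (v 5) (v 6) (v 7)) = ?S 1 3 4 - ?S 3 1 4 + ?S 4 1 3"
    unfolding alternation_diff[symmetric] alternation_add[symmetric]
    by (simp only: distrib_left right_diff_distrib distrib_right left_diff_distrib)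
  ultimately show ?thesis
    by (simp add: cyc alternation_zero)
qed

text \<open>The analogue for a closed 3-form: after swaps the four terms of \<open>cyc\<close> all
  contribute the same amount.\<close>

lemma alternation_third:
  fixes A :: "real ^ 7 \<Rightarrow> real ^ 7 \<Rightarrow> real ^ 7 \<Rightarrow> real ^ 7 \<Rightarrow> real"
  assumes skew: "\<And>t u v w. A t u v w = - A t v u w" "\<And>t u v w. A t u v w = - A t u w v"
    and cyc: "\<And>t u v w. A t u v w - A u t v w + A v t u w - A w t u v = 0"
  shows "alternation (\<lambda>v. a (v 2) * b (v 3) (v 4) * A (v 1) (v 5) (v 6) (v 7)) = 0"
proof -
  let ?S = "\<lambda>i j k l. alternation (\<lambda>v. a (v (2::7)) * b (v 3) (v 4) * A (v i) (v j) (v k) (v l))"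
  let ?F = "\<lambda>v. a (v (2::7)) * b (v 3) (v 4) * A (v 1) (v 5) (v 6) (v 7)"
  have rot: "A t u v w = A t w u v" for t u v w
    by (metis skew minus_minus)
  have "?S 5 1 6 7 = - ?S 1 5 6 7"
    using alternation_swap[of "1::7" 5 ?F] by simp
  moreover have "?S 6 1 5 7 = ?S 1 5 6 7"
    using alternation_swap[of "1::7" 6 ?F]
    by (simp add: skew(1)[of "v 6" "v 5" "v 1" "v 7" for v] alternation_minus)
  moreover have "?S 7 1 5 6 = - ?S 1 5 6 7"
    using alternation_swap[of "1::7" 7 ?F] by (simp add: rot[of "v 7" "v 5" "v 6" "v 1" for v])
  moreover have "alternation (\<lambda>v. a (v 2) * b (v 3) (v 4) * (A (v 1) (v 5) (v 6) (v 7) - A (v 5) (v 1) (v 6) (v 7) +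
      A (v 6) (v 1) (v 5) (v 7) - A (v 7) (v 1) (v 5) (v 6))) =
      ?S 1 5 6 7 - ?S 5 1 6 7 + ?S 6 1 5 7 - ?S 7 1 5 6"
    unfolding alternation_diff[symmetric] alternation_add[symmetric]
    by (simp only: distrib_left right_diff_distrib)
  ultimately show ?thesis
    by (simp add: cyc alternation_zero)
qed

lemma UNIV_7: "(UNIV :: 7 set) = {1, 2, 3, 4, 5, 6, 7}"
  by (rule card_subset_eq[symmetric]) (auto simp: card_insert_if)

lemma linear_cmult_right: "linear f \<Longrightarrow> linear (\<lambda>u. f u * (c::real))"
  and linear_cmult_left: "linear f \<Longrightarrow> linear (\<lambda>u. (c::real) * f u)"
  using linear_compose_scale_right[of f c] by (simp_all add: mult.commute)

lemma form7_multilinear: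
  assumes "\<And>v. linear (\<lambda>u. b u v)" "\<And>u. linear (b u)" "\<And>v. linear (\<lambda>u. b' u v)" "\<And>u. linear (b' u)"
    and "\<And>v w. linear (\<lambda>u. f u v w)" "\<And>u w. linear (\<lambda>v. f u v w)" "\<And>u v. linear (f u v)"
  shows "linear (\<lambda>u. form7 b b' f (v(i := u)))"
proof -
  have "i \<in> {1, 2, 3, 4, 5, 6, 7}"
    using UNIV_7 by auto
  then show ?thesis
    unfolding form7_def
    by (elim insertE emptyE; simp) (intro linear_cmult_right linear_cmult_left assms)+
qed

text \<open>The vector density dual to the 6-form a \<and> b \<and> f: slot 1 is left free and
  receives the vector. For alternating arguments a linear functional \<xi> takes on it 12 times the
  value of \<xi> \<and> a \<and> b \<and> f on the standard basis, and \<open>linear_vector7\<close>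
  is this fact before normalisation.\<close>

definition vector7 :: "(real ^ 7 \<Rightarrow> real) \<Rightarrow> (real ^ 7 \<Rightarrow> real ^ 7 \<Rightarrow> real) \<Rightarrow>
    (real ^ 7 \<Rightarrow> real ^ 7 \<Rightarrow> real ^ 7 \<Rightarrow> real) \<Rightarrow> real ^ 7" where
  "vector7 a b f = (\<Sum>p | p permutes UNIV. (of_int (sign p) *
     (a (axis (p 2) 1) * b (axis (p 3) 1) (axis (p 4) 1) * f (axis (p 5) 1) (axis (p 6) 1) (axis (p 7) 1)))
     *\<^sub>R axis (p 1) 1)"

lemma linear_vector7:
  assumes "linear \<xi>"
  shows "\<xi> (vector7 a b f) = alternation (form7 (\<lambda>u v. \<xi> u * a v) b f)"
  unfolding vector7_def alternation_def form7_def linear_sum[OF assms] linear_scale[OF assms]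
  by (simp add: mult_ac)

lemma alternation_form7_transform:
  assumes "linear L"
    and "\<And>v. linear (\<lambda>u. b u v)" "\<And>u. linear (b u)" "\<And>v. linear (\<lambda>u. b' u v)" "\<And>u. linear (b' u)"
    and "\<And>v w. linear (\<lambda>u. f u v w)" "\<And>u w. linear (\<lambda>v. f u v w)" "\<And>u v. linear (f u v)"
  shows "alternation (form7 (\<lambda>u v. b (L u) (L v)) (\<lambda>u v. b' (L u) (L v)) (\<lambda>u v w. f (L u) (L v) (L w))) =
    det (matrix L) * alternation (form7 b b' f)"
  using alternation_linear_image[OF form7_multilinear[OF assms(2-)] assms(1)]
  by (simp add: form7_def[abs_def])

text \<open>Tested against each coordinate functional, this becomes the determinant law for
  \<open>alternation\<close>, with the composition of that functional and \<open>L\<close> in the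
  first slot.\<close>

lemma vector7_transform:
  assumes L: "linear L" and a: "linear a"
    and b: "\<And>v. linear (\<lambda>u. b u v)" "\<And>u. linear (b u)"
    and f: "\<And>v w. linear (\<lambda>u. f u v w)" "\<And>u w. linear (\<lambda>v. f u v w)" "\<And>u v. linear (f u v)"
  shows "L (vector7 (\<lambda>u. a (L u)) (\<lambda>u v. b (L u) (L v)) (\<lambda>u v w. f (L u) (L v) (L w))) =
    det (matrix L) *\<^sub>R vector7 a b f"
proof (rule vec_eq_iff[THEN iffD2], rule allI)
  fix k
  have nth: "linear (\<lambda>u::real^7. u $ k)"
    by (simp add: bounded_linear.linear bounded_linear_vec_nth)
  have "L (vector7 (\<lambda>u. a (L u)) (\<lambda>u v. b (L u) (L v)) (\<lambda>u v w. f (L u) (L v) (L w))) $ k =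
      alternation (form7 (\<lambda>u v. L u $ k * a (L v)) (\<lambda>u v. b (L u) (L v)) (\<lambda>u v w. f (L u) (L v) (L w)))"
    using linear_vector7[OF linear_compose[OF L nth, unfolded comp_def]] .
  also have "\<dots> = det (matrix L) * alternation (form7 (\<lambda>u v. u $ k * a v) b f)"
    by (rule alternation_form7_transform[OF L, of "\<lambda>u v. u $ k * a v"])
      (intro linear_cmult_right linear_cmult_left nth a b f)+
  also have "alternation (form7 (\<lambda>u v. u $ k * a v) b f) = vector7 a b f $ k"
    using linear_vector7[OF nth] by metis
  finally show "L (vector7 (\<lambda>u. a (L u)) (\<lambda>u v. b (L u) (L v)) (\<lambda>u v w. f (L u) (L v) (L w))) $ k =
      (det (matrix L) *\<^sub>R vector7 a b f) $ k"
    by simp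
qed

lemma C1_on_vector7:
  assumes "\<And>u. C1_on U (\<lambda>x. a x u)" "\<And>u v. C1_on U (\<lambda>x. b x u v)" "\<And>u v w. C1_on U (\<lambda>x. f x u v w)"
  shows "C1_on U (\<lambda>x. vector7 (a x) (b x) (f x))"
  unfolding vector7_def
  by (intro C1_on_sum C1_on_scaleR C1_on_mult C1_on_const assms) simp

text \<open>This is d(a \<and> b \<and> f) = da \<and> b \<and> f for closed b and f. The product
  rule gives three terms: the one differentiating \<open>a\<close> yields half the alternation,
  since da = b, and the other two vanish by \<open>db\<close> and \<open>df\<close>.\<close>

lemma divergence_vector7:
  fixes a :: "real ^ 7 \<Rightarrow> real ^ 7 \<Rightarrow> real" and b :: "real ^ 7 \<Rightarrow> real ^ 7 \<Rightarrow> real ^ 7 \<Rightarrow> real"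
    and f :: "real ^ 7 \<Rightarrow> real ^ 7 \<Rightarrow> real ^ 7 \<Rightarrow> real ^ 7 \<Rightarrow> real"
  assumes U: "open U" "x \<in> U"
    and a: "\<And>u. C1_on U (\<lambda>x. a x u)"
    and b: "\<And>u v. C1_on U (\<lambda>x. b x u v)"
    and f: "\<And>u v w. C1_on U (\<lambda>x. f x u v w)"
    and skew: "\<And>y u v. y \<in> U \<Longrightarrow> b y u v = - b y v u"
      "\<And>y u v w. y \<in> U \<Longrightarrow> f y u v w = - f y v u w" "\<And>y u v w. y \<in> U \<Longrightarrow> f y u v w = - f y u w v"
    and da: "\<And>u v. frechet_derivative (\<lambda>x. a x v) (at x) u - frechet_derivative (\<lambda>x. a x u) (at x) v = b x u v"
    and db: "\<And>u v w. frechet_derivative (\<lambda>x. b x v w) (at x) u -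
      frechet_derivative (\<lambda>x. b x u w) (at x) v + frechet_derivative (\<lambda>x. b x u v) (at x) w = 0"
    and df: "\<And>t u v w. frechet_derivative (\<lambda>x. f x u v w) (at x) t - frechet_derivative (\<lambda>x. f x t v w) (at x) u +
      frechet_derivative (\<lambda>x. f x t u w) (at x) v - frechet_derivative (\<lambda>x. f x t u v) (at x) w = 0"
  shows "divergence (\<lambda>x. vector7 (a x) (b x) (f x)) x = 1/2 * alternation (form7 (b x) (b x) (f x))"
proof -
  let ?a = "\<lambda>v u. frechet_derivative (\<lambda>x. a x u) (at x) v"
  let ?b = "\<lambda>z u v. frechet_derivative (\<lambda>x. b x u v) (at x) z"
  let ?f = "\<lambda>z u v w. frechet_derivative (\<lambda>x. f x u v w) (at x) z"
  let ?e = "\<lambda>i. axis i 1 :: real ^ 7"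
  \<comment> \<open>The derivative in direction \<open>z\<close> of the product in
    \<open>vector7\<close>, evaluated at the vectors \<open>p\<close>.\<close>
  define G' where "G' = (\<lambda>z p. ?a z (p 2) * b x (p 3) (p 4) * f x (p 5) (p 6) (p 7) +
     a x (p 2) * ?b z (p 3) (p 4) * f x (p 5) (p 6) (p 7) +
     a x (p 2) * b x (p 3) (p 4) * ?f z (p 5) (p 6) (p (7::7)))"
  \<comment> \<open>Skew symmetry holds near \<open>x\<close> and so passes to the derivatives of
    \<open>b\<close> and \<open>f\<close>.\<close>
  have neg: "frechet_derivative g (at x) z = - frechet_derivative h (at x) z"
    if g: "C1_on U g" and gh: "\<And>y. y \<in> U \<Longrightarrow> h y = - g y" for g h :: "real ^ 7 \<Rightarrow> real" and z
  proof -
    have "(h has_derivative (\<lambda>v. - frechet_derivative g (at x) v)) (at x)"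
      by (rule has_derivative_transform_within_open[OF has_derivative_minus[OF C1_on_has_derivative[OF g U(2)]] U])
        (simp add: gh)
    then have "(\<lambda>v. - frechet_derivative g (at x) v) = frechet_derivative h (at x)"
      by (rule frechet_derivative_at)
    then show ?thesis
      by (metis minus_minus)
  qed
  have deriv: "((\<lambda>x. vector7 (a x) (b x) (f x)) has_derivative
      (\<lambda>z. \<Sum>p | p permutes UNIV. (of_int (sign p) * G' z (\<lambda>i. ?e (p i))) *\<^sub>R ?e (p 1))) (at x)"
    unfolding vector7_def
  proof (intro has_derivative_sum has_derivative_scaleR_left)
    fix p :: "7 \<Rightarrow> 7"
    have "((\<lambda>x. a x (?e (p 2)) * b x (?e (p 3)) (?e (p 4)) * f x (?e (p 5)) (?e (p 6)) (?e (p 7)))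
        has_derivative (\<lambda>z. G' z (\<lambda>i. ?e (p i)))) (at x)"
      by (rule has_derivative_eq_rhs[OF has_derivative_mult[OF has_derivative_mult[OF
            C1_on_has_derivative[OF a U(2)] C1_on_has_derivative[OF b U(2)]] C1_on_has_derivative[OF f U(2)]]])
        (simp add: G'_def fun_eq_iff algebra_simps)
    then show "((\<lambda>x. of_int (sign p) * (a x (?e (p 2)) * b x (?e (p 3)) (?e (p 4)) *
          f x (?e (p 5)) (?e (p 6)) (?e (p 7))))
        has_derivative (\<lambda>z. of_int (sign p) * G' z (\<lambda>i. ?e (p i)))) (at x)"
      by (rule has_derivative_mult_right)
  qed
  have "divergence (\<lambda>x. vector7 (a x) (b x) (f x)) x =
      (\<Sum>i\<in>UNIV. \<Sum>p | p permutes UNIV. of_int (sign p) * G' (?e i) (\<lambda>j. ?e (p j)) * ?e (p 1) $ i)"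
    unfolding divergence_def frechet_derivative_at[OF deriv, symmetric] by simp
  also have "\<dots> = (\<Sum>p | p permutes UNIV. \<Sum>i\<in>UNIV. of_int (sign p) * G' (?e i) (\<lambda>j. ?e (p j)) * ?e (p 1) $ i)"
    by (rule sum.swap)
  \<comment> \<open>The summand of the permutation \<open>p\<close> points along the basis vector
    with index \<open>p 1\<close>, so the trace keeps only \<open>i = p 1\<close>. The direction of
    differentiation thereby becomes slot 1 of an alternation.\<close>
  also have "\<dots> = (\<Sum>p | p permutes UNIV. of_int (sign p) * G' (?e (p 1)) (\<lambda>j. ?e (p j)))"
    by (simp add: axis_def if_distrib[of "(*) _"] cong: if_cong)
  also have "\<dots> = alternation (\<lambda>v. G' (v 1) v)"
    by (simp add: alternation_def)
  also have "\<dots> = alternation (form7 ?a (b x) (f x)) +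
      alternation (\<lambda>v. a x (v 2) * ?b (v 1) (v 3) (v 4) * f x (v 5) (v 6) (v 7)) +
      alternation (\<lambda>v. a x (v 2) * b x (v 3) (v 4) * ?f (v 1) (v 5) (v 6) (v 7))"
    unfolding G'_def form7_def[abs_def] by (simp only: alternation_add[symmetric])
  also have "alternation (\<lambda>v. a x (v 2) * ?b (v 1) (v 3) (v 4) * f x (v 5) (v 6) (v 7)) = 0"
    by (rule alternation_second[where A = ?b, OF neg db]) (rule b, rule skew(1))
  also have "alternation (\<lambda>v. a x (v 2) * b x (v 3) (v 4) * ?f (v 1) (v 5) (v 6) (v 7)) = 0"
    by (rule alternation_third[where A = ?f, OF neg neg df]) (rule f, rule skew(2), assumption, rule f, rule skew(3))
  also have "alternation (form7 ?a (b x) (f x)) = 1/2 * alternation (form7 (b x) (b x) (f x))"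
    by (subst alternation_first) (simp add: da)
  finally show ?thesis
    by simp
qed

section \<open>The model form\<close>

text \<open>The minor of the coordinates i, j, k, which is the form \<open>e3 i j k\<close> as a
  function of three vectors.\<close>

definition det3 :: "7 \<Rightarrow> 7 \<Rightarrow> 7 \<Rightarrow> real ^ 7 \<Rightarrow> real ^ 7 \<Rightarrow> real ^ 7 \<Rightarrow> real" where
  "det3 i j k u v w = u $ i * v $ j * w $ k + v $ i * w $ j * u $ k + w $ i * u $ j * v $ k
    - u $ i * w $ j * v $ k - v $ i * u $ j * w $ k - w $ i * v $ j * u $ k"

text \<open>The sequence continues with the last vector; a 3-form looks only at the first three
  entries.\<close>

definition tri :: "'v form \<Rightarrow> 'v \<Rightarrow> 'v \<Rightarrow> 'v \<Rightarrow> real" where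
  "tri \<omega> u v w = \<omega> (case_nat u (case_nat v (\<lambda>_. w)))"

lemma permutes_empty_set: "{p. p permutes {}} = {id}"
  by auto

lemma wedge_dx_dx: "wedge 1 1 (dx i) (dx j) v = v 0 $ i * v 1 $ j - v 1 $ i * v 0 $ j"
proof -
  have "{..<1 + 1 :: nat} = insert 0 (insert 1 {})"
    by auto
  then show ?thesis
    by (simp add: wedge_def dx_def sum_over_permutations_insert permutes_empty_set sign_swap_id
        sign_id sign_compose permutation_swap_id Transposition.transpose_def)
qed

lemma e3_eq: "e3 i j k v = det3 i j k (v 0) (v 1) (v 2)"
proof -
  have "{..<1 + 2 :: nat} = insert 0 (insert 1 (insert 2 {}))"
    by auto
  then show ?thesis
    unfolding e3_def det3_def wedge_def[of 1 2] wedge_dx_dx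
    by (simp add: dx_def sum_over_permutations_insert permutes_empty_set
        sign_swap_id sign_id sign_compose permutation_swap_id permutation_compose
        Transposition.transpose_def numeral_2_eq_2[symmetric] fact_2 field_simps)
qed

definition phi3 :: "real ^ 7 \<Rightarrow> real ^ 7 \<Rightarrow> real ^ 7 \<Rightarrow> real" where
  "phi3 u v w = det3 1 2 3 u v w + det3 1 4 5 u v w + det3 1 6 7 u v w + det3 2 4 6 u v w
     - det3 2 5 7 u v w - det3 3 4 7 u v w - det3 3 5 6 u v w"

lemma tri_phi0: "tri phi0 = phi3"
  by (simp add: fun_eq_iff tri_def phi0_def e3_eq phi3_def numeral_2_eq_2)

text \<open>Permuting slots 5, 6, 7 leaves the other factor alone, so the six monomials of the
  minor, taken with their signs, contribute equally.\<close>

lemma alternation_det3: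
  "alternation (\<lambda>v. B (v 1) (v 2) (v 3) (v 4) * det3 i j k (v 5) (v 6) (v 7)) =
    6 * alternation (\<lambda>v. B (v 1) (v 2) (v 3) (v 4) * (v 5 $ i * v 6 $ j * v 7 $ k))"
proof -
  let ?S = "\<lambda>i j k. alternation (\<lambda>v. B (v (1::7)) (v 2) (v 3) (v 4) * (v 5 $ i * v 6 $ j * v 7 $ k))"
  have s: "?S j i k = - ?S i j k" for i j k
    using alternation_swap[of "5::7" 6 "\<lambda>v. B (v 1) (v 2) (v 3) (v 4) * (v 5 $ i * v 6 $ j * v 7 $ k)"]
    by (simp add: mult_ac)
  have t: "?S i k j = - ?S i j k" for i j k
    using alternation_swap[of "6::7" 7 "\<lambda>v. B (v 1) (v 2) (v 3) (v 4) * (v 5 $ i * v 6 $ j * v 7 $ k)"]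
    by (simp add: mult_ac)
  have "(\<lambda>v. B (v 1) (v 2) (v 3) (v 4) * det3 i j k (v 5) (v 6) (v 7)) =
     (\<lambda>v. B (v 1) (v 2) (v 3) (v 4) * (v 5 $ i * v 6 $ j * v 7 $ k)
        + B (v 1) (v 2) (v 3) (v 4) * (v 5 $ k * v 6 $ i * v 7 $ j)
        + B (v 1) (v 2) (v 3) (v 4) * (v 5 $ j * v 6 $ k * v 7 $ i)
        - B (v 1) (v 2) (v 3) (v 4) * (v 5 $ i * v 6 $ k * v 7 $ j)
        - B (v 1) (v 2) (v 3) (v 4) * (v 5 $ j * v 6 $ i * v 7 $ k)
        - B (v 1) (v 2) (v 3) (v 4) * (v 5 $ k * v 6 $ j * v (7::7) $ i))"
    unfolding det3_def by (rule ext) algebra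
  then have "alternation (\<lambda>v. B (v 1) (v 2) (v 3) (v 4) * det3 i j k (v 5) (v 6) (v 7)) =
      ?S i j k + ?S k i j + ?S j k i - ?S i k j - ?S j i k - ?S k j i"
    by (simp only: alternation_add alternation_diff)
  also have "\<dots> = 6 * ?S i j k"
    using s[of i j k] t[of i j k] s[of i k j] t[of j i k] s[of j k i] by linarith
  finally show ?thesis .
qed

text \<open>The delta functions in the last three slots restrict the sum over all permutations to a coset
  of the permutations of the first four indices.\<close>

lemma alternation_restrict:
  fixes q :: "7 \<Rightarrow> 7"
  assumes q: "q permutes UNIV"
  shows "alternation (\<lambda>v. B (v 1) (v 2) (v 3) (v 4) * (v 5 $ q 5 * v 6 $ q 6 * v 7 $ q 7)) =
    of_int (sign q) * (\<Sum>r | r permutes {1, 2, 3, 4}. of_int (sign r) *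
      B (axis (q (r 1)) 1) (axis (q (r 2)) 1) (axis (q (r 3)) 1) (axis (q (r 4)) 1))"
proof -
  let ?B = "\<lambda>p. B (axis (p 1) 1) (axis (p 2) 1) (axis (p 3) 1) (axis (p (4::7)) (1::real))"
  let ?R = "{r. r permutes {1, 2, 3, 4 :: 7}}"
  have inj: "inj q"
    using q by (rule permutes_inj)
  have "alternation (\<lambda>v. B (v 1) (v 2) (v 3) (v 4) * (v 5 $ q 5 * v 6 $ q 6 * v 7 $ q 7)) =
      (\<Sum>p | p permutes UNIV. of_int (sign (q \<circ> p)) * (?B (q \<circ> p) *
        (axis (q (p 5)) 1 $ q 5 * axis (q (p 6)) 1 $ q 6 * axis (q (p 7)) 1 $ q 7)))"
    unfolding alternation_def by (subst setum_permutations_compose_left[OF q]) simp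
  also have "\<dots> = (\<Sum>r\<in>?R. of_int (sign (q \<circ> r)) * ?B (q \<circ> r))"
  proof (rule sum.mono_neutral_cong_right)
    show "?R \<subseteq> {p. p permutes UNIV}"
      by (auto intro: permutes_subset)
    show "\<forall>p\<in>{p. p permutes UNIV} - ?R. of_int (sign (q \<circ> p)) * (?B (q \<circ> p) *
        (axis (q (p 5)) 1 $ q 5 * axis (q (p 6)) 1 $ q 6 * axis (q (p 7)) 1 $ q 7)) = 0"
    proof
      fix p assume p: "p \<in> {p. p permutes (UNIV :: 7 set)} - ?R"
      have "\<not> (p 5 = 5 \<and> p 6 = 6 \<and> p 7 = 7)"
      proof
        assume *: "p 5 = 5 \<and> p 6 = 6 \<and> p 7 = 7"
        have "p x = x" if "x \<notin> {1, 2, 3, 4}" for x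
          using that * UNIV_7 by (metis UNIV_I insertE insertI1 insertI2 singletonD)
        then have "p permutes {1, 2, 3, 4}"
          using p by (auto simp: permutes_def)
        then show False
          using p by simp
      qed
      then show "of_int (sign (q \<circ> p)) * (?B (q \<circ> p) *
        (axis (q (p 5)) 1 $ q 5 * axis (q (p 6)) 1 $ q 6 * axis (q (p 7)) 1 $ q 7)) = 0"
        by (auto simp: axis_def inj_eq[OF inj])
    qed
    fix r assume "r \<in> ?R"
    then have "r 5 = 5 \<and> r 6 = 6 \<and> r 7 = 7"
      by (auto simp: permutes_def)
    then show "of_int (sign (q \<circ> r)) * (?B (q \<circ> r) *
        (axis (q (r 5)) 1 $ q 5 * axis (q (r 6)) 1 $ q 6 * axis (q (r 7)) 1 $ q 7)) =
        of_int (sign (q \<circ> r)) * ?B (q \<circ> r)"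
      by (simp add: axis_def)
  qed simp
  also have "\<dots> = of_int (sign q) * (\<Sum>r\<in>?R. of_int (sign r) * ?B (q \<circ> r))"
  proof -
    have "sign (q \<circ> r) = sign q * sign r" if "r \<in> ?R" for r
      using that q by (intro sign_compose) (auto simp: permutation_permutes)
    then show ?thesis
      by (simp add: sum_distrib_left mult.assoc)
  qed
  finally show ?thesis
    by simp
qed

text \<open>The Pfaffian of a skew 4 by 4 matrix. Each of the three pairings of the four indices
  arises from 8 permutations: both pairs may be reversed and the pairs exchanged.\<close>

lemma sum_permutes_4:
  fixes \<beta> :: "7 \<Rightarrow> 7 \<Rightarrow> real"
  assumes "\<And>i j. \<beta> j i = - \<beta> i j"
  shows "(\<Sum>r | r permutes {1, 2, 3, 4 :: 7}. of_int (sign r) * (\<beta> (r 1) (r 2) * \<beta> (r 3) (r 4))) =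
    8 * (\<beta> 1 2 * \<beta> 3 4 - \<beta> 1 3 * \<beta> 2 4 + \<beta> 1 4 * \<beta> 2 3)"
  using assms[of 1 2] assms[of 1 3] assms[of 1 4] assms[of 2 3] assms[of 2 4] assms[of 3 4]
  by (simp add: sum_over_permutations_insert permutes_empty_set sign_swap_id sign_id sign_compose
      permutation_swap_id permutation_compose)

text \<open>Against e^{ijk} only the values of \<open>b\<close> on the four complementary
  coordinates survive, and they enter through the Pfaffian. The constant is 48 = 6 * 8, with 6 from
  the minor and 8 from the pairings.\<close>

lemma alternation_pfaffian:
  fixes q :: "7 \<Rightarrow> 7" and b :: "real ^ 7 \<Rightarrow> real ^ 7 \<Rightarrow> real"
  assumes q: "q permutes UNIV" and skew: "\<And>u v. b v u = - b u v"
  shows "alternation (form7 b b (det3 (q 5) (q 6) (q 7))) = 48 * of_int (sign q) *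
    (b (axis (q 1) 1) (axis (q 2) 1) * b (axis (q 3) 1) (axis (q 4) 1)
     - b (axis (q 1) 1) (axis (q 3) 1) * b (axis (q 2) 1) (axis (q 4) 1)
     + b (axis (q 1) 1) (axis (q 4) 1) * b (axis (q 2) 1) (axis (q 3) 1))"
  using alternation_det3[of "\<lambda>u v w z. b u v * b w z" "q 5" "q 6" "q 7"]
    alternation_restrict[OF q, of "\<lambda>u v w z. b u v * b w z"]
    sum_permutes_4[of "\<lambda>i j. b (axis (q i) 1) (axis (q j) 1)", OF skew]
  by (simp add: form7_def[abs_def])

lemma phi3_skew: "phi3 u v w = - phi3 v u w" "phi3 u v w = - phi3 u w v"
  by (simp_all add: phi3_def det3_def)

lemma form7_phi3:
  "form7 b b phi3 v = form7 b b (det3 1 2 3) v + form7 b b (det3 1 4 5) v + form7 b b (det3 1 6 7) v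
    + form7 b b (det3 2 4 6) v - form7 b b (det3 2 5 7) v - form7 b b (det3 3 4 7) v - form7 b b (det3 3 5 6) v"
  by (simp add: form7_def phi3_def algebra_simps)

text \<open>For distinct i, j, k a permutation taking 5, 6, 7 to them, as
  \<open>alternation_pfaffian\<close> expects. Each transposition sets one more value and keeps
  those already set; as a product of transpositions it has a computable sign.\<close>

definition place :: "7 \<Rightarrow> 7 \<Rightarrow> 7 \<Rightarrow> 7 \<Rightarrow> 7" where
  "place i j k = (let q1 = Transposition.transpose 5 i; q2 = Transposition.transpose (q1 6) j \<circ> q1
     in Transposition.transpose (q2 7) k \<circ> q2)"

lemma place_permutes: "place i j k permutes UNIV"
  unfolding place_def Let_def by (intro permutes_compose permutes_swap_id) auto

lemma place_values:
  shows "map (place 1 2 3) [1, 2, 3, 4, 5, 6, 7] = [5, 6, 7, 4, 1, 2, 3]" "sign (place 1 2 3) = -1"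
  "map (place 1 4 5) [1, 2, 3, 4, 5, 6, 7] = [7, 2, 3, 6, 1, 4, 5]" "sign (place 1 4 5) = -1"
  "map (place 1 6 7) [1, 2, 3, 4, 5, 6, 7] = [5, 2, 3, 4, 1, 6, 7]" "sign (place 1 6 7) = -1"
  "map (place 2 4 6) [1, 2, 3, 4, 5, 6, 7] = [1, 5, 3, 7, 2, 4, 6]" "sign (place 2 4 6) = -1"
  "map (place 2 5 7) [1, 2, 3, 4, 5, 6, 7] = [1, 6, 3, 4, 2, 5, 7]" "sign (place 2 5 7) = 1"
  "map (place 3 4 7) [1, 2, 3, 4, 5, 6, 7] = [1, 2, 5, 6, 3, 4, 7]" "sign (place 3 4 7) = 1"
  "map (place 3 5 6) [1, 2, 3, 4, 5, 6, 7] = [1, 2, 7, 4, 3, 5, 6]" "sign (place 3 5 6) = -1"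
  by (simp_all add: place_def Let_def sign_compose sign_swap_id permutation_compose permutation_swap_id)

lemma alternation_triple:
  assumes "map (place i j k) [1, 2, 3, 4, 5, 6, 7] = [a, b, c, d, i, j, k]" and "sign (place i j k) = s"
  shows "alternation (form7 (phi3 u) (phi3 u) (det3 i j k)) = 48 * of_int s *
    (phi3 u (axis a 1) (axis b 1) * phi3 u (axis c 1) (axis d 1)
     - phi3 u (axis a 1) (axis c 1) * phi3 u (axis b 1) (axis d 1)
     + phi3 u (axis a 1) (axis d 1) * phi3 u (axis b 1) (axis c 1))"
  using alternation_pfaffian[OF place_permutes[of i j k], of "phi3 u", OF phi3_skew(2)] assms by simp

text \<open>This is the identity (\<iota>_u \<phi>) \<and> (\<iota>_u \<phi>) \<and> \<phi> = 6
  |u|^2 Vol for the model form, multiplied by 24. Each of the seven terms of the form gives 48 times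
  a signed Pfaffian that is quadratic in the coordinates of \<open>u\<close>, and together these
  Pfaffians amount to 3 |u|^2.\<close>

lemma alternation_phi3:
  "alternation (form7 (phi3 u) (phi3 u) phi3) = 144 * (u \<bullet> u)"
proof -
  have "u \<bullet> u = (u $ 1)\<^sup>2 + (u $ 2)\<^sup>2 + (u $ 3)\<^sup>2 + (u $ 4)\<^sup>2 + (u $ 5)\<^sup>2 + (u $ 6)\<^sup>2 + (u $ 7)\<^sup>2"
    unfolding inner_vec_def UNIV_7 by (simp add: power2_eq_square)
  then show ?thesis
    unfolding form7_phi3[abs_def] alternation_add alternation_diff
      alternation_triple[OF place_values(1,2)]
      alternation_triple[OF place_values(3,4)]
      alternation_triple[OF place_values(5,6)]
      alternation_triple[OF place_values(7,8)]
      alternation_triple[OF place_values(9,10)]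
      alternation_triple[OF place_values(11,12)]
      alternation_triple[OF place_values(13,14)]
    by (simp add: phi3_def det3_def axis_def power2_eq_square)
qed

section \<open>Contact structures and closed \<open>G\<^sub>2\<close>-structures\<close>

lemma alternating_form_cong:
  "alternating_form k \<omega> \<Longrightarrow> (\<And>i. i < k \<Longrightarrow> v i = w i) \<Longrightarrow> \<omega> v = \<omega> w"
  unfolding alternating_form_def by blast

lemma alternating_form_linear:
  "alternating_form k \<omega> \<Longrightarrow> i < k \<Longrightarrow> linear (\<lambda>u. \<omega> (v(i := u)))"
  unfolding alternating_form_def by blast

lemma alternating_form_eq_0:
  "alternating_form k \<omega> \<Longrightarrow> i < j \<Longrightarrow> j < k \<Longrightarrow> v i = v j \<Longrightarrow> \<omega> v = 0"
  unfolding alternating_form_def by blast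

lemma linear_alternating_1:
  assumes "alternating_form 1 \<omega>"
  shows "linear (\<lambda>u. \<omega> (\<lambda>_. u))"
proof -
  have "(\<lambda>u. \<omega> (\<lambda>_. u)) = (\<lambda>u. \<omega> ((\<lambda>_. 0)(0 := u)))"
    by (rule ext, rule alternating_form_cong[OF assms]) simp
  then show ?thesis
    using alternating_form_linear[OF assms, of 0] by simp
qed

lemma nat_less_3: "i < 3 \<longleftrightarrow> i = 0 \<or> i = Suc 0 \<or> i = Suc (Suc (0::nat))"
  by auto

lemma tri_cong:
  assumes "alternating_form 3 \<omega>"
  shows "\<omega> v = tri \<omega> (v 0) (v 1) (v 2)"
  unfolding tri_def
  by (rule alternating_form_cong[OF assms]) (auto simp: nat_less_3 numeral_2_eq_2)

lemma tri_linear: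
  assumes "alternating_form 3 \<omega>"
  shows "linear (\<lambda>u. tri \<omega> u v w)" "linear (\<lambda>v. tri \<omega> u v w)" "linear (tri \<omega> u v)"
proof -
  let ?v = "case_nat u (case_nat v (\<lambda>_. w))"
  have *: "linear (\<lambda>z. tri \<omega> ((?v(i := z)) 0) ((?v(i := z)) 1) ((?v(i := z)) 2))" if "i < 3" for i
    using alternating_form_linear[OF assms that] by (simp only: tri_cong[OF assms, symmetric])
  show "linear (\<lambda>u. tri \<omega> u v w)"
    using *[of 0] by (simp add: numeral_2_eq_2)
  show "linear (\<lambda>v. tri \<omega> u v w)"
    using *[of 1] by (simp add: numeral_2_eq_2)
  show "linear (tri \<omega> u v)"
    using *[of 2] by (simp add: numeral_2_eq_2)
qed

lemma tri_skew:
  assumes "alternating_form 3 \<omega>"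
  shows "tri \<omega> u v w = - tri \<omega> v u w" "tri \<omega> u v w = - tri \<omega> u w v"
proof -
  have 1: "tri \<omega> u u w = 0" for u w
    unfolding tri_def by (rule alternating_form_eq_0[OF assms, of 0 1]) auto
  have 2: "tri \<omega> u w w = 0" for u w
    unfolding tri_def by (rule alternating_form_eq_0[OF assms, of 1 2]) (auto simp: numeral_2_eq_2)
  note add = tri_linear[OF assms, THEN linear_add]
  have "tri \<omega> (u + v) (u + v) w = tri \<omega> u v w + tri \<omega> v u w"
    by (simp only: add) (simp add: 1)
  with 1[of "u + v" w] show "tri \<omega> u v w = - tri \<omega> v u w"
    by linarith
  have "tri \<omega> u (v + w) (v + w) = tri \<omega> u v w + tri \<omega> u w v"
    by (simp only: add) (simp add: 2)
  with 2[of u "v + w"] show "tri \<omega> u v w = - tri \<omega> u w v"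
    by linarith
qed

lemma tri_pullback: "tri (pullback_form L \<omega>) u v w = tri \<omega> (L u) (L v) (L w)"
proof -
  have "(\<lambda>i. L (case_nat u (case_nat v (\<lambda>_. w)) i)) = case_nat (L u) (case_nat (L v) (\<lambda>_. L w))"
    by (auto split: nat.split)
  then show ?thesis
    by (simp add: tri_def pullback_form_def)
qed

lemma smooth_on_frechet_derivative:
  "smooth_on U f \<Longrightarrow> smooth_on U (\<lambda>x. frechet_derivative f (at x) v)"
  unfolding smooth_on_def
proof
  fix k assume "\<forall>k. Ck_on k U f"
  then have "Ck_on (Suc k) U f" ..
  then show "Ck_on k U (\<lambda>x. frechet_derivative f (at x) v)"
    by (simp add: Ck_on.simps)
qed

text \<open>Omitting entry 1 leaves a sequence that begins with \<open>u\<close> and continues with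
  \<open>w\<close>. It agrees with the constant sequence \<open>u\<close> only in entry 0, which is
  all that a 1-form sees, on a whole neighbourhood of \<open>x\<close>.\<close>

lemma ext_deriv_1_eq:
  assumes U: "open U" "x \<in> U" and alt: "\<And>y. y \<in> U \<Longrightarrow> alternating_form 1 (\<omega> y)"
    and smooth: "\<And>v. smooth_on U (\<lambda>x. \<omega> x v)"
  shows "ext_deriv 1 \<omega> x (case_nat u (\<lambda>_. w)) =
    frechet_derivative (\<lambda>y. \<omega> y (\<lambda>_. w)) (at x) u - frechet_derivative (\<lambda>y. \<omega> y (\<lambda>_. u)) (at x) w"
proof -
  let ?v = "\<lambda>j. case_nat u (\<lambda>_. w) (if j < 1 then j else Suc j)"
  have "frechet_derivative (\<lambda>y. \<omega> y ?v) (at x) = frechet_derivative (\<lambda>y. \<omega> y (\<lambda>_. u)) (at x)"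
  proof (rule frechet_derivative_transform_within_open[OF _ U])
    show "(\<lambda>y. \<omega> y ?v) differentiable at x"
      using smooth_on_C1[OF smooth[of ?v]] U by (simp add: Ck_on.simps)
    show "\<omega> y ?v = \<omega> y (\<lambda>_. u)" if "y \<in> U" for y
      by (rule alternating_form_cong[OF alt[OF that]]) simp
  qed
  then show ?thesis
    by (simp add: ext_deriv_def)
qed

lemma ext_deriv_3_eq:
  assumes U: "open U" "x \<in> U" and alt: "\<And>y. y \<in> U \<Longrightarrow> alternating_form 3 (\<omega> y)"
    and smooth: "\<And>v. smooth_on U (\<lambda>x. \<omega> x v)"
  shows "ext_deriv 3 \<omega> x (case_nat t (case_nat u (case_nat v (\<lambda>_. w)))) =
    frechet_derivative (\<lambda>y. tri (\<omega> y) u v w) (at x) t - frechet_derivative (\<lambda>y. tri (\<omega> y) t v w) (at x) u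
    + frechet_derivative (\<lambda>y. tri (\<omega> y) t u w) (at x) v - frechet_derivative (\<lambda>y. tri (\<omega> y) t u v) (at x) w"
proof -
  have eq: "frechet_derivative (\<lambda>y. \<omega> y z) (at x) = frechet_derivative (\<lambda>y. tri (\<omega> y) (z 0) (z 1) (z 2)) (at x)" for z
  proof (rule frechet_derivative_transform_within_open[OF _ U])
    show "(\<lambda>y. \<omega> y z) differentiable at x"
      using smooth_on_C1[OF smooth[of z]] U by (simp add: Ck_on.simps)
    show "\<omega> y z = tri (\<omega> y) (z 0) (z 1) (z 2)" if "y \<in> U" for y
      by (rule tri_cong[OF alt[OF that]])
  qed
  have "{..3::nat} = {0, 1, 2, 3}"
    by auto
  then show ?thesis
    unfolding ext_deriv_def eq by (simp add: numeral_2_eq_2 numeral_3_eq_3)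
qed

theorem theorem4p3:
  fixes X :: "'a topology"
    and A :: "('a, real ^ 7) chart set"
    and \<phi> :: "('a, real ^ 7) dform"
  assumes "smooth_manifold X A"
    and "topspace X \<noteq> {}"
    and "G2_structure A \<phi>"
    and "form_eq A (ext_deriv_dform 3 \<phi>) zero_dform"
    and "compact_space X"
  shows "\<not> (\<exists>\<xi>. contact_structure A \<xi> \<and> A_compatible X A \<phi> \<xi>)"
proof
  assume "\<exists>\<xi>. contact_structure A \<xi> \<and> A_compatible X A \<phi> \<xi>"
  \<comment> \<open>\<alpha> is the contact form whose derivative is \<iota>_R \<phi>; \<beta>,
    whose Reeb field is a multiple of \<open>R\<close>, shows that \<open>R\<close> has no
    zero.\<close>
  then obtain \<xi> R h \<alpha> \<beta> where R: "vector_field A R"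
    and \<alpha>: "contact_form_for A \<xi> \<alpha>" and d\<alpha>: "form_eq A (ext_deriv_dform 1 \<alpha>) (interior_dform R \<phi>)"
    and \<beta>: "contact_form_for A \<xi> \<beta>" and reeb: "reeb_vector_field A \<beta> (scale_vfield h R)"
    unfolding A_compatible_def by blast
  interpret manifold X A
    by standard (rule assms(1))
  have form\<alpha>: "diff_form A 1 \<alpha>" and form\<beta>: "diff_form A 1 \<beta>" and form\<phi>: "diff_form A 3 \<phi>"
    using \<alpha> \<beta> assms(3) by (simp_all add: contact_form_for_def contact_form_def G2_structure_def)
  have alt\<alpha>: "alternating_form 1 (\<alpha> c x)" and alt\<beta>: "alternating_form 1 (\<beta> c x)"
    and alt\<phi>: "alternating_form 3 (\<phi> c x)" if "c \<in> A" "x \<in> chart_image c" for c x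
    using form\<alpha> form\<beta> form\<phi> that by (simp_all add: diff_form_def)
  have smooth\<alpha>: "smooth_on (chart_image c) (\<lambda>x. \<alpha> c x v)"
    and smooth\<phi>: "smooth_on (chart_image c) (\<lambda>x. \<phi> c x v)" if "c \<in> A" for c v
    using form\<alpha> form\<phi> that by (simp_all add: diff_form_def)
  define a where "a = (\<lambda>c x u. \<alpha> c x (\<lambda>_. u))"
  define f where "f = (\<lambda>c x. tri (\<phi> c x))"
  \<comment> \<open>Two readings of one 2-form: as \<iota>_R \<phi> it inherits linearity, skew
    symmetry and the transition law from \<phi>; as d\<alpha>, by \<open>da\<close> below, it is
    differentiable and closed.\<close>
  define b where "b = (\<lambda>c x. f c x (R c x))"
  define Y where "Y = (\<lambda>c x. vector7 (a c x) (b c x) (f c x))"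
  \<comment> \<open>The factor 1/2 makes this the divergence of \<open>Y\<close>, by
    \<open>divergence_vector7\<close>.\<close>
  define T where "T = (\<lambda>c x. 1/2 * alternation (form7 (b c x) (b c x) (f c x)))"
  have lina: "linear (a c x)" if "c \<in> A" "x \<in> chart_image c" for c x
    unfolding a_def by (rule linear_alternating_1[OF alt\<alpha>[OF that]])
  have linf: "linear (\<lambda>u. f c x u v w)" "linear (\<lambda>v. f c x u v w)" "linear (f c x u v)"
    if "c \<in> A" "x \<in> chart_image c" for c x u v w
    unfolding f_def by (rule tri_linear[OF alt\<phi>[OF that]])+
  have linb: "linear (\<lambda>u. b c x u v)" "linear (b c x u)" if "c \<in> A" "x \<in> chart_image c" for c x u v
    unfolding b_def by (rule linf[OF that])+
  have f_skew: "f c x u v w = - f c x v u w" "f c x u v w = - f c x u w v"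
    if "c \<in> A" "x \<in> chart_image c" for c x u v w
    unfolding f_def by (rule tri_skew[OF alt\<phi>[OF that]])+
  have da: "b c x u v = frechet_derivative (\<lambda>x. a c x v) (at x) u - frechet_derivative (\<lambda>x. a c x u) (at x) v"
    if c: "c \<in> A" "x \<in> chart_image c" for c x u v
  proof -
    have "ext_deriv 1 (\<alpha> c) x (case_nat u (\<lambda>_. v)) = b c x u v"
      using d\<alpha> c by (simp add: form_eq_def ext_deriv_dform_def interior_dform_def interior_product_def
          b_def f_def tri_def)
    then show ?thesis
      unfolding a_def
      using ext_deriv_1_eq[OF open_chart_image[OF c(1)] c(2) alt\<alpha>[OF c(1)] smooth\<alpha>[OF c(1)]] by simp
  qed
  have C1a: "C1_on (chart_image c) (\<lambda>x. a c x u)"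
    and C1Da: "C1_on (chart_image c) (\<lambda>x. frechet_derivative (\<lambda>x. a c x u) (at x) v)"
    and C2a: "Ck_on 2 (chart_image c) (\<lambda>x. a c x u)"
    and C1f: "C1_on (chart_image c) (\<lambda>x. f c x u v w)" if c: "c \<in> A" for c u v w
    unfolding a_def f_def tri_def
    by (rule smooth_on_C1 smooth_on_frechet_derivative smooth\<alpha>[OF c] smooth\<phi>[OF c]
        smooth\<alpha>[OF c, unfolded smooth_on_def, THEN spec])+
  have C1D: "C1_on (chart_image c) (\<lambda>x. frechet_derivative (\<lambda>x. a c x v) (at x) u +
      - 1 * frechet_derivative (\<lambda>x. a c x u) (at x) v)" if c: "c \<in> A" for c u v
    by (intro C1_on_add C1_on_mult C1_on_const C1Da c)
  have C1b: "C1_on (chart_image c) (\<lambda>x. b c x u v)" if c: "c \<in> A" for c u v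
    by (rule C1_on_cong[OF open_chart_image[OF c] C1D[OF c]]) (simp add: da[OF c])
  have Db: "frechet_derivative (\<lambda>x. b c x u v) (at x) w =
      frechet_derivative (\<lambda>x. frechet_derivative (\<lambda>x. a c x v) (at x) u) (at x) w -
      frechet_derivative (\<lambda>x. frechet_derivative (\<lambda>x. a c x u) (at x) v) (at x) w"
    if c: "c \<in> A" "x \<in> chart_image c" for c x u v w
  proof -
    have "((\<lambda>x. b c x u v) has_derivative (\<lambda>w.
      frechet_derivative (\<lambda>x. frechet_derivative (\<lambda>x. a c x v) (at x) u) (at x) w -
      frechet_derivative (\<lambda>x. frechet_derivative (\<lambda>x. a c x u) (at x) v) (at x) w)) (at x)"
      by (rule has_derivative_transform_within_open[OF has_derivative_diff[OF
            C1_on_has_derivative[OF C1Da[OF c(1)] c(2)] C1_on_has_derivative[OF C1Da[OF c(1)] c(2)]]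
            open_chart_image[OF c(1)] c(2)]) (simp add: da[OF c(1)])
    from frechet_derivative_at[OF this, symmetric] show ?thesis
      by (rule fun_cong)
  qed
  have db: "frechet_derivative (\<lambda>x. b c x v w) (at x) u -
      frechet_derivative (\<lambda>x. b c x u w) (at x) v + frechet_derivative (\<lambda>x. b c x u v) (at x) w = 0"
    if c: "c \<in> A" "x \<in> chart_image c" for c x u v w
  proof -
    \<comment> \<open>d(d\<alpha>) = 0: the six second derivatives of \<open>a\<close> cancel in
      pairs.\<close>
    note sym = frechet_derivative_symmetric[OF open_chart_image[OF c(1)] c(2) C2a[OF c(1)]]
    show ?thesis
      unfolding Db[OF c] using sym[of w v u] sym[of v w u] sym[of u w v] by linarith
  qed
  have df: "frechet_derivative (\<lambda>x. f c x u v w) (at x) t - frechet_derivative (\<lambda>x. f c x t v w) (at x) u +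
      frechet_derivative (\<lambda>x. f c x t u w) (at x) v - frechet_derivative (\<lambda>x. f c x t u v) (at x) w = 0"
    if c: "c \<in> A" "x \<in> chart_image c" for c x t u v w
  proof -
    have "ext_deriv 3 (\<phi> c) x z = 0" for z
      using assms(4) c by (simp add: form_eq_def ext_deriv_dform_def zero_dform_def)
    then show ?thesis
      unfolding f_def
      using ext_deriv_3_eq[OF open_chart_image[OF c(1)] c(2) alt\<phi>[OF c(1)] smooth\<phi>[OF c(1)]] by simp
  qed
  have a_transition: "a c x u = a c' (transition c c' x) (frechet_derivative (transition c c') (at x) u)"
    and f_transition: "f c x u v w = f c' (transition c c' x) (frechet_derivative (transition c c') (at x) u)
      (frechet_derivative (transition c c') (at x) v) (frechet_derivative (transition c c') (at x) w)"
    and R_transition: "R c' (transition c c' x) = frechet_derivative (transition c c') (at x) (R c x)"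
    if "c \<in> A" "c' \<in> A" "x \<in> overlap c c'" for c c' x u v w
  proof -
    have "\<alpha> c x = pullback_form (frechet_derivative (transition c c') (at x)) (\<alpha> c' (transition c c' x))"
      "\<phi> c x = pullback_form (frechet_derivative (transition c c') (at x)) (\<phi> c' (transition c c' x))"
      using form\<alpha> form\<phi> that unfolding diff_form_def by blast+
    then show "a c x u = a c' (transition c c' x) (frechet_derivative (transition c c') (at x) u)"
      "f c x u v w = f c' (transition c c' x) (frechet_derivative (transition c c') (at x) u)
      (frechet_derivative (transition c c') (at x) v) (frechet_derivative (transition c c') (at x) w)"
      by (simp_all add: a_def f_def tri_pullback) (simp add: pullback_form_def)
    show "R c' (transition c c' x) = frechet_derivative (transition c c') (at x) (R c x)"
      using R that unfolding vector_field_def by blast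
  qed
  have b_transition: "b c x u v = b c' (transition c c' x) (frechet_derivative (transition c c') (at x) u)
      (frechet_derivative (transition c c') (at x) v)" if "c \<in> A" "c' \<in> A" "x \<in> overlap c c'" for c c' x u v
    unfolding b_def R_transition[OF that] by (rule f_transition[OF that])
  \<comment> \<open>At a zero of \<open>R\<close> its multiple would vanish too, but \<beta> takes
    the value 1 on its Reeb field.\<close>
  have R_nonzero: "R c x \<noteq> 0" if c: "c \<in> A" "x \<in> chart_image c" for c x
  proof
    assume "R c x = 0"
    have "\<forall>c\<in>A. \<forall>x\<in>chart_image c. \<beta> c x (\<lambda>_. scale_vfield h R c x) = 1"
      using reeb unfolding reeb_vector_field_def by (elim conjE)
    from bspec[OF bspec[OF this c(1)] c(2)] \<open>R c x = 0\<close> have "\<beta> c x (\<lambda>_. 0) = 1"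
      by (simp add: scale_vfield_def)
    then show False
      using linear_0[OF linear_alternating_1[OF alt\<beta>[OF c]]] by simp
  qed
  have "T c x \<noteq> 0" if c: "c \<in> A" "x \<in> chart_image c" for c x
  proof -
    obtain L where L: "linear L" "bij L" "pullback_form L (\<phi> c x) = phi0"
      using assms(3) c unfolding G2_structure_def by blast
    define u where "u = inv L (R c x)"
    have Lu: "L u = R c x"
      using L(2) by (simp add: u_def bij_is_surj surj_f_inv_f)
    then have "u \<noteq> 0"
      using R_nonzero[OF c] linear_0[OF L(1)] by auto
    have f: "(\<lambda>u v w. f c x (L u) (L v) (L w)) = phi3"
      unfolding f_def tri_pullback[symmetric] L(3) tri_phi0 ..
    then have b: "(\<lambda>v w. b c x (L v) (L w)) = phi3 u"
      unfolding b_def Lu[symmetric] by (simp add: fun_eq_iff)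
    \<comment> \<open>In the frame \<open>L\<close> the 3-form is the model form and
      \<open>R\<close> has coordinates \<open>u\<close>. The right-hand side is positive, so the
      alternation on the left cannot be 0.\<close>
    have "det (matrix L) * alternation (form7 (b c x) (b c x) (f c x)) = 144 * (u \<bullet> u)"
      using alternation_form7_transform[OF L(1) linb[OF c] linb[OF c] linf[OF c]]
      unfolding f b alternation_phi3 by simp
    then show ?thesis
      using \<open>u \<noteq> 0\<close> by (auto simp: T_def)
  qed
  moreover have "linear (frechet_derivative (transition c c') (at x))" "transition c c' x \<in> chart_image c'"
    if "c \<in> A" "c' \<in> A" "x \<in> overlap c c'" for c c' x
    using has_derivative_linear[OF has_derivative_transition[OF that]] transition_in_overlap[OF that]
      overlap_subset[OF that(2)] by blast+
  note tr = this
  moreover have "frechet_derivative (transition c c') (at x) (Y c x) =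
      det (matrix (frechet_derivative (transition c c') (at x))) *\<^sub>R Y c' (transition c c' x)"
    if c: "c \<in> A" "c' \<in> A" "x \<in> overlap c c'" for c c' x
    using vector7_transform[OF tr(1)[OF c] lina linb linf, OF c(2) tr(2)[OF c] c(2) tr(2)[OF c] c(2) tr(2)[OF c]
        c(2) tr(2)[OF c] c(2) tr(2)[OF c] c(2) tr(2)[OF c]]
    unfolding Y_def a_transition[OF c, symmetric] b_transition[OF c, symmetric] f_transition[OF c, symmetric] .
  moreover have "T c x = det (matrix (frechet_derivative (transition c c') (at x))) * T c' (transition c c' x)"
    if c: "c \<in> A" "c' \<in> A" "x \<in> overlap c c'" for c c' x
    using alternation_form7_transform[OF tr(1)[OF c] linb[OF c(2) tr(2)[OF c]] linb[OF c(2) tr(2)[OF c]]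
        linf[OF c(2) tr(2)[OF c]]]
    unfolding T_def b_transition[OF c, symmetric] f_transition[OF c, symmetric] by simp
  moreover have "T c x = divergence (Y c) x" if c: "c \<in> A" "x \<in> chart_image c" for c x
  proof -
    have "divergence (\<lambda>x. vector7 (a c x) (b c x) (f c x)) x = 1/2 * alternation (form7 (b c x) (b c x) (f c x))"
    proof (rule divergence_vector7[OF open_chart_image[OF c(1)] c(2) C1a[OF c(1)] C1b[OF c(1)] C1f[OF c(1)]
        _ f_skew[OF c(1)] da[OF c, symmetric] db[OF c] df[OF c]])
      show "b c y u v = - b c y v u" if "y \<in> chart_image c" for y u v
        unfolding b_def by (rule f_skew(2)[OF c(1) that])
    qed
    then show ?thesis
      by (simp only: T_def Y_def)
  qed
  moreover have "C1_on (chart_image c) (Y c)" if c: "c \<in> A" for c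
    unfolding Y_def by (intro C1_on_vector7 C1a C1b C1f c)
  ultimately interpret exact_volume X A Y T
    by unfold_locales
  show False
    using not_compact assms(2,5) by blast
qed

end
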